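(* Let $V$ be a nontrivial irreducible weight module over the twisted Heisenberg-Virasoro algebra $\mathbb{L}$ with weight multiplicity one. Then $V\simeq V(\alpha,\beta;F)$ for some $\alpha,\beta,F\in\mathbb{C}$, or $V\simeq V'(0,0;0)$.
   Context: The twisted Heisenberg-Virasoro algebra $\mathbb{L}$ is the complex Lie algebra with basis $\{x_n, I(n), C_D, C_{DI}, C_I : n\in\mathbb{Z}\}$ and bracket $[x_n,x_m]=(m-n)x_{n+m}+\delta_{n,-m}\frac{n^3-n}{12}C_D$, $[x_n,I(m)]=mI(n+m)+\delta_{n,-m}(n^2+n)C_{DI}$, $[I(n),I(m)]=n\delta_{n,-m}C_I$, $[\mathbb{L},C_D]=[\mathbb{L},C_{DI}]=[\mathbb{L},C_I]=0$. A nonzero $\mathbb{L}$-module $V$ is trivial if $\mathbb{L}V=0$. For $(\lambda,\lambda_I,c_D,c_{DI},c_I)\in\mathbb{C}^5$ the corresponding weight space of $V$ is $\{v\in V: x_0v=\lambda v,\ I(0)v=\lambda_I v,\ C_Dv=c_Dv,\ C_{DI}v=c_{DI}v,\ C_Iv=c_Iv\}$. $V$ is a weight module if it is the sum of all its weight spaces. It has weight multiplicity one if every nonzero weight space is one-dimensional. For $\alpha,\beta,F\in\mathbb{C}$, $V(\alpha,\beta;F)$ is the $\mathbb{L}$-module with basis $\{v_{\alpha+n}: n\in\mathbb{Z}\}$ and action $x_iv_{\alpha+k}=(\alpha+k+\beta i)v_{\alpha+i+k}$, $I(i)v_{\alpha+k}=Fv_{\alpha+k+i}$, and $C_D,C_{DI},C_I$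 acting as $0$ $(i,k\in\mathbb{Z})$. $V'(0,0;0)$ denotes the unique (up to isomorphism) nontrivial irreducible subquotient of $V(0,0;0)$ and of $V(0,1;0)$; concretely, it is the submodule of $V(0,1;0)$ spanned by $\{v_k: k\neq 0\}$ (equivalently $V(0,0;0)/\mathbb{C}v_0$). *)

theory Defs
  imports Complex_Main "HOL-Library.Poly_Mapping"
begin

section \<open>Complex Lie algebras and their modules\<close>

locale complex_lie_algebra = vector_space scale
  for scale :: "complex \<Rightarrow> 'l::ab_group_add \<Rightarrow> 'l" +
  fixes bracket :: "'l \<Rightarrow> 'l \<Rightarrow> 'l"
  assumes linear_bracket_left: "Vector_Spaces.linear scale scale (\<lambda>x. bracket x y)"
    and linear_bracket_right: "Vector_Spaces.linear scale scale (bracket x)"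
    and bracket_self: "bracket x x = 0"
    and jacobi: "bracket x (bracket y z) + bracket y (bracket z x) + bracket z (bracket x y) = 0"

locale lie_module =
  L: complex_lie_algebra scaleL bracket + V: vector_space scaleV
  for scaleL :: "complex \<Rightarrow> 'l::ab_group_add \<Rightarrow> 'l"
    and bracket :: "'l \<Rightarrow> 'l \<Rightarrow> 'l"
    and scaleV :: "complex \<Rightarrow> 'v::ab_group_add \<Rightarrow> 'v" +
  fixes act :: "'l \<Rightarrow> 'v \<Rightarrow> 'v"
  assumes linear_act_left: "Vector_Spaces.linear scaleL scaleV (\<lambda>x. act x v)"
    and linear_act_right: "Vector_Spaces.linear scaleV scaleV (act x)"
    and act_bracket: "act (bracket x y) v = act x (act y v) - act y (act x v)"

definition trivial_module :: "('l \<Rightarrow> 'v::ab_group_add \<Rightarrow> 'v) \<Rightarrow> bool" where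
  "trivial_module act \<longleftrightarrow> (\<exists>v::'v. v \<noteq> 0) \<and> (\<forall>x v. act x v = 0)"

definition submodule ::
  "(complex \<Rightarrow> 'v::ab_group_add \<Rightarrow> 'v) \<Rightarrow> ('l \<Rightarrow> 'v \<Rightarrow> 'v) \<Rightarrow> 'v set \<Rightarrow> bool" where
  "submodule scale act W \<longleftrightarrow> module.subspace scale W \<and> (\<forall>x. \<forall>w\<in>W. act x w \<in> W)"

definition irreducible_module ::
  "(complex \<Rightarrow> 'v::ab_group_add \<Rightarrow> 'v) \<Rightarrow> ('l \<Rightarrow> 'v \<Rightarrow> 'v) \<Rightarrow> bool" where
  "irreducible_module scale act \<longleftrightarrow>
     (\<exists>v::'v. v \<noteq> 0) \<and> (\<forall>W. submodule scale act W \<longrightarrow> W = {0} \<or> W = UNIV)"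

text \<open>
  Isomorphism of a submodule \<open>S1\<close> of one module with a submodule \<open>S2\<close> of another; a module
  itself is represented by the submodule \<^const>\<open>UNIV\<close>.
\<close>

definition module_isomorphic ::
  "(complex \<Rightarrow> 'v::ab_group_add \<Rightarrow> 'v) \<Rightarrow> ('l \<Rightarrow> 'v \<Rightarrow> 'v) \<Rightarrow> 'v set \<Rightarrow>
   (complex \<Rightarrow> 'w::ab_group_add \<Rightarrow> 'w) \<Rightarrow> ('l \<Rightarrow> 'w \<Rightarrow> 'w) \<Rightarrow> 'w set \<Rightarrow> bool" where
  "module_isomorphic s1 act1 S1 s2 act2 S2 \<longleftrightarrow>
     (\<exists>f. bij_betw f S1 S2
        \<and> (\<forall>u\<in>S1. \<forall>v\<in>S1. f (u + v) = f u + f v)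
        \<and> (\<forall>c. \<forall>v\<in>S1. f (s1 c v) = s2 c (f v))
        \<and> (\<forall>x. \<forall>v\<in>S1. f (act1 x v) = act2 x (f v)))"


section \<open>Vector spaces with a given basis\<close>

text \<open>
  The complex vector space with basis indexed by a type \<open>'a\<close> is \<open>'a \<Rightarrow>\<^sub>0 complex\<close>; the basis
  vector of index \<open>a\<close> is \<open>Poly_Mapping.single a 1\<close>.
\<close>

definition fscale :: "complex \<Rightarrow> ('a \<Rightarrow>\<^sub>0 complex) \<Rightarrow> ('a \<Rightarrow>\<^sub>0 complex)" where
  "fscale c f = Poly_Mapping.map ((*) c) f"

definition bilinear_ext ::
  "('a \<Rightarrow> 'b \<Rightarrow> ('c \<Rightarrow>\<^sub>0 complex)) \<Rightarrow> ('a \<Rightarrow>\<^sub>0 complex) \<Rightarrow> ('b \<Rightarrow>\<^sub>0 complex) \<Rightarrow> ('c \<Rightarrow>\<^sub>0 complex)" where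
  "bilinear_ext h f g =
     (\<Sum>a\<in>Poly_Mapping.keys f. \<Sum>b\<in>Poly_Mapping.keys g.
        fscale (Poly_Mapping.lookup f a * Poly_Mapping.lookup g b) (h a b))"


section \<open>The twisted Heisenberg-Virasoro algebra\<close>

text \<open>\<open>X n\<close> and \<open>I n\<close> index the basis elements written $x_n$ and $I(n)$.\<close>

datatype hv_index = X int | I int | C_D | C_DI | C_I

type_synonym hv = "hv_index \<Rightarrow>\<^sub>0 complex"

abbreviation hv_basis :: "hv_index \<Rightarrow> hv" where
  "hv_basis b \<equiv> Poly_Mapping.single b 1"

fun hv_bracket_basis :: "hv_index \<Rightarrow> hv_index \<Rightarrow> hv" where
  "hv_bracket_basis (X n) (X m) =
     fscale (of_int (m - n)) (hv_basis (X (n + m)))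
     + fscale (if n = - m then (of_int n ^ 3 - of_int n) / 12 else 0) (hv_basis C_D)"
| "hv_bracket_basis (X n) (I m) =
     fscale (of_int m) (hv_basis (I (n + m)))
     + fscale (if n = - m then of_int n ^ 2 + of_int n else 0) (hv_basis C_DI)"
| "hv_bracket_basis (I m) (X n) =
     - (fscale (of_int m) (hv_basis (I (n + m)))
        + fscale (if n = - m then of_int n ^ 2 + of_int n else 0) (hv_basis C_DI))"
| "hv_bracket_basis (I n) (I m) =
     fscale (if n = - m then of_int n else 0) (hv_basis C_I)"
| "hv_bracket_basis _ _ = 0"

definition hv_bracket :: "hv \<Rightarrow> hv \<Rightarrow> hv" where
  "hv_bracket = bilinear_ext hv_bracket_basis"

abbreviation hv_module ::
  "(complex \<Rightarrow> 'v::ab_group_add \<Rightarrow> 'v) \<Rightarrow> (hv \<Rightarrow> 'v \<Rightarrow> 'v) \<Rightarrow> bool" where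
  "hv_module \<equiv> lie_module fscale hv_bracket"


section \<open>Weight modules\<close>

definition weight_space ::
  "(complex \<Rightarrow> 'v::ab_group_add \<Rightarrow> 'v) \<Rightarrow> (hv \<Rightarrow> 'v \<Rightarrow> 'v) \<Rightarrow>
   complex \<times> complex \<times> complex \<times> complex \<times> complex \<Rightarrow> 'v set" where
  "weight_space scale act = (\<lambda>(l, l', cD, cDI, cI).
     {v. act (hv_basis (X 0)) v = scale l v
       \<and> act (hv_basis (I 0)) v = scale l' v
       \<and> act (hv_basis C_D) v = scale cD v
       \<and> act (hv_basis C_DI) v = scale cDI v
       \<and> act (hv_basis C_I) v = scale cI v})"

text \<open>The sum of a family of subspaces is the span of their union.\<close>

definition weight_module ::
  "(complex \<Rightarrow> 'v::ab_group_add \<Rightarrow> 'v) \<Rightarrow> (hv \<Rightarrow> 'v \<Rightarrow> 'v) \<Rightarrow> bool" where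
  "weight_module scale act \<longleftrightarrow> module.span scale (\<Union>w. weight_space scale act w) = UNIV"

text \<open>
  \<open>vector_space.dim\<close> is 0 for infinite-dimensional spaces, so dimension 1 really is
  one-dimensionality.
\<close>

definition weight_multiplicity_one ::
  "(complex \<Rightarrow> 'v::ab_group_add \<Rightarrow> 'v) \<Rightarrow> (hv \<Rightarrow> 'v \<Rightarrow> 'v) \<Rightarrow> bool" where
  "weight_multiplicity_one scale act \<longleftrightarrow>
     (\<forall>w. weight_space scale act w \<noteq> {0}
        \<longrightarrow> vector_space.dim scale (weight_space scale act w) = 1)"


section \<open>The modules $V(\alpha,\beta;F)$ and $V'(0,0;0)$\<close>

text \<open>
  The underlying space is \<open>int \<Rightarrow>\<^sub>0 complex\<close> for all parameters, with the basis vector of index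
  \<open>k\<close> standing for $v_{\alpha+k}$.
\<close>

fun intermediate_act_basis ::
  "complex \<Rightarrow> complex \<Rightarrow> complex \<Rightarrow> hv_index \<Rightarrow> int \<Rightarrow> (int \<Rightarrow>\<^sub>0 complex)" where
  "intermediate_act_basis \<alpha> \<beta> F (X i) k =
     fscale (\<alpha> + of_int k + \<beta> * of_int i) (Poly_Mapping.single (i + k) 1)"
| "intermediate_act_basis \<alpha> \<beta> F (I i) k = fscale F (Poly_Mapping.single (k + i) 1)"
| "intermediate_act_basis \<alpha> \<beta> F _ k = 0"

definition intermediate_act ::
  "complex \<Rightarrow> complex \<Rightarrow> complex \<Rightarrow> hv \<Rightarrow> (int \<Rightarrow>\<^sub>0 complex) \<Rightarrow> (int \<Rightarrow>\<^sub>0 complex)" where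
  "intermediate_act \<alpha> \<beta> F = bilinear_ext (intermediate_act_basis \<alpha> \<beta> F)"

text \<open>$V'(0,0;0)$ is the following submodule of $V(0,1;0)$, with action \<open>intermediate_act 0 1 0\<close>.\<close>

definition V_prime :: "(int \<Rightarrow>\<^sub>0 complex) set" where
  "V_prime = module.span fscale {Poly_Mapping.single k 1 | k. k \<noteq> 0}"


section \<open>The definitions above do give a Lie algebra and modules\<close>

lemma lookup_fscale [simp]:
  "Poly_Mapping.lookup (fscale c f) k = c * Poly_Mapping.lookup f k"
  by (simp add: fscale_def Poly_Mapping.map.rep_eq when_def)

lemma vector_space_fscale: "vector_space fscale"
  by unfold_locales
    (auto intro!: poly_mapping_eqI simp: lookup_add algebra_simps)

lemma fscale_single [simp]: "fscale c (Poly_Mapping.single a d) = Poly_Mapping.single a (c * d)"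
  by (rule poly_mapping_eqI) (simp add: lookup_single when_def)

lemma fscale_zero [simp]: "fscale c 0 = 0" "fscale 0 f = 0"
  by (auto intro!: poly_mapping_eqI)

lemma fscale_minus: "fscale c (- f) = - fscale c f"
  by (rule poly_mapping_eqI) simp

lemma fscale_add: "fscale c (f + g) = fscale c f + fscale c g"
  by (rule poly_mapping_eqI) (simp add: lookup_add algebra_simps)

lemma fscale_fscale [simp]: "fscale c (fscale d f) = fscale (c * d) f"
  by (rule poly_mapping_eqI) (simp add: algebra_simps)

lemma linear_fscaleI:
  assumes "\<And>x y. f (x + y) = f x + f y" and "\<And>c x. f (fscale c x) = fscale c (f x)"
  shows "Vector_Spaces.linear fscale fscale f"
  using assms by (simp add: Vector_Spaces.linear_iff vector_space_fscale)

lemma lookup_bilinear_ext: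
  assumes "finite A" "Poly_Mapping.keys f \<subseteq> A" "finite B" "Poly_Mapping.keys g \<subseteq> B"
  shows "Poly_Mapping.lookup (bilinear_ext h f g) c =
    (\<Sum>a\<in>A. \<Sum>b\<in>B. Poly_Mapping.lookup f a * Poly_Mapping.lookup g b * Poly_Mapping.lookup (h a b) c)"
proof -
  have "Poly_Mapping.lookup (bilinear_ext h f g) c =
    (\<Sum>a\<in>Poly_Mapping.keys f. \<Sum>b\<in>Poly_Mapping.keys g.
       Poly_Mapping.lookup f a * Poly_Mapping.lookup g b * Poly_Mapping.lookup (h a b) c)"
    by (simp add: bilinear_ext_def lookup_sum)
  also have "\<dots> = (\<Sum>a\<in>Poly_Mapping.keys f. \<Sum>b\<in>B.
       Poly_Mapping.lookup f a * Poly_Mapping.lookup g b * Poly_Mapping.lookup (h a b) c)"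
    using assms by (intro sum.cong sum.mono_neutral_left) (auto simp: in_keys_iff)
  also have "\<dots> = (\<Sum>a\<in>A. \<Sum>b\<in>B.
       Poly_Mapping.lookup f a * Poly_Mapping.lookup g b * Poly_Mapping.lookup (h a b) c)"
    using assms by (intro sum.mono_neutral_left) (auto simp: in_keys_iff)
  finally show ?thesis .
qed

lemma keys_fscale: "Poly_Mapping.keys (fscale c f) \<subseteq> Poly_Mapping.keys f"
  by (auto simp: in_keys_iff)

lemma bilinear_ext_add_left: "bilinear_ext h (f + f') g = bilinear_ext h f g + bilinear_ext h f' g"
proof (rule poly_mapping_eqI)
  fix c
  let ?A = "Poly_Mapping.keys f \<union> Poly_Mapping.keys f'" and ?B = "Poly_Mapping.keys g"
  have k: "Poly_Mapping.keys (f + f') \<subseteq> ?A" by (rule Poly_Mapping.keys_add)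
  show "Poly_Mapping.lookup (bilinear_ext h (f + f') g) c =
        Poly_Mapping.lookup (bilinear_ext h f g + bilinear_ext h f' g) c"
    using k by (simp add: lookup_add lookup_bilinear_ext[of ?A _ ?B] distrib_right sum.distrib)
qed

lemma bilinear_ext_add_right: "bilinear_ext h f (g + g') = bilinear_ext h f g + bilinear_ext h f g'"
proof (rule poly_mapping_eqI)
  fix c
  let ?B = "Poly_Mapping.keys g \<union> Poly_Mapping.keys g'" and ?A = "Poly_Mapping.keys f"
  have k: "Poly_Mapping.keys (g + g') \<subseteq> ?B" by (rule Poly_Mapping.keys_add)
  show "Poly_Mapping.lookup (bilinear_ext h f (g + g')) c =
        Poly_Mapping.lookup (bilinear_ext h f g + bilinear_ext h f g') c"
    using k by (simp add: lookup_add lookup_bilinear_ext[of ?A _ ?B] distrib_left distrib_right sum.distrib)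
qed

lemma bilinear_ext_scale_left: "bilinear_ext h (fscale c f) g = fscale c (bilinear_ext h f g)"
  by (rule poly_mapping_eqI)
    (simp add: lookup_bilinear_ext[of "Poly_Mapping.keys f" _ "Poly_Mapping.keys g"]
      keys_fscale sum_distrib_left mult.assoc)

lemma bilinear_ext_scale_right: "bilinear_ext h f (fscale c g) = fscale c (bilinear_ext h f g)"
  by (rule poly_mapping_eqI)
    (simp add: lookup_bilinear_ext[of "Poly_Mapping.keys f" _ "Poly_Mapping.keys g"]
      keys_fscale sum_distrib_left mult_ac)

lemma bilinear_ext_zero [simp]: "bilinear_ext h 0 g = 0" "bilinear_ext h f 0 = 0"
  by (simp_all add: bilinear_ext_def)

lemma bilinear_ext_single [simp]:
  "bilinear_ext h (Poly_Mapping.single a c) (Poly_Mapping.single b d) = fscale (c * d) (h a b)"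
  by (simp add: bilinear_ext_def)

lemma poly_mapping_basis_induct [case_names zero single add]:
  fixes f :: "'a \<Rightarrow>\<^sub>0 complex"
  assumes "P 0" "\<And>a c. P (Poly_Mapping.single a c)" "\<And>f g. P f \<Longrightarrow> P g \<Longrightarrow> P (f + g)"
  shows "P f"
proof -
  have f: "f = (\<Sum>a\<in>Poly_Mapping.keys f. Poly_Mapping.single a (Poly_Mapping.lookup f a))"
    by (rule poly_mapping_eqI)
      (simp add: lookup_sum lookup_single when_def in_keys_iff)
  have "P (\<Sum>a\<in>A. Poly_Mapping.single a (Poly_Mapping.lookup f a))" if "finite A" for A
    using that by (induction A) (auto intro: assms)
  from this[of "Poly_Mapping.keys f"] show ?thesis using f by simp
qed


lemma linear_bilinear_ext:
  "Vector_Spaces.linear fscale fscale (\<lambda>f. bilinear_ext h f g)"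
  "Vector_Spaces.linear fscale fscale (bilinear_ext h f)"
  by (intro linear_fscaleI bilinear_ext_add_left bilinear_ext_add_right
      bilinear_ext_scale_left bilinear_ext_scale_right)+

lemmas bilinear_ext_add = bilinear_ext_add_left bilinear_ext_add_right

lemma hv_bracket_antisym: "hv_bracket f g = - hv_bracket g f"
proof (induction f rule: poly_mapping_basis_induct)
  case (single a c)
  show ?case
  proof (induction g rule: poly_mapping_basis_induct)
    case (single b d)
    show ?case
      by (cases a; cases b; rule poly_mapping_eqI)
        (auto simp: hv_bracket_def lookup_add lookup_minus lookup_single when_def algebra_simps diff_divide_distrib)
  qed (simp_all add: hv_bracket_def bilinear_ext_add)
qed (simp_all add: hv_bracket_def bilinear_ext_add)

lemma hv_bracket_simps:
  "hv_bracket (f + g) h = hv_bracket f h + hv_bracket g h"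
  "hv_bracket h (f + g) = hv_bracket h f + hv_bracket h g"
  "hv_bracket 0 h = 0" "hv_bracket h 0 = 0"
  "hv_bracket (Poly_Mapping.single a c) (Poly_Mapping.single b d) = fscale (c * d) (hv_bracket_basis a b)"
  by (simp_all add: hv_bracket_def bilinear_ext_add)

definition hv_jac :: "hv \<Rightarrow> hv \<Rightarrow> hv \<Rightarrow> hv" where
  "hv_jac f g h =
     hv_bracket f (hv_bracket g h) + hv_bracket g (hv_bracket h f) + hv_bracket h (hv_bracket f g)"

lemma hv_jac_cyclic: "hv_jac f g h = hv_jac g h f"
  by (simp add: hv_jac_def algebra_simps)

lemma hv_jac_scale: "hv_jac (fscale p f) (fscale q g) (fscale r h) = fscale (p * q * r) (hv_jac f g h)"
  by (simp add: hv_jac_def hv_bracket_def bilinear_ext_scale_left bilinear_ext_scale_right fscale_add mult_ac)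

lemma hv_jac_basis:
  "hv_jac (hv_basis (X n)) (hv_basis (X m)) (hv_basis (X k)) = 0"
  "hv_jac (hv_basis (X n)) (hv_basis (X m)) (hv_basis (I k)) = 0"
  "hv_jac (hv_basis (X n)) (hv_basis (I m)) (hv_basis (I k)) = 0"
proof -
  note s = hv_jac_def hv_bracket_simps fscale_add fscale_minus single_uminus[symmetric]
    lookup_add lookup_minus lookup_single when_def
  have [simp]: "n = - (m + k) \<longleftrightarrow> n + m + k = 0" "m = - (k + n) \<longleftrightarrow> n + m + k = 0"
      "m = - (n + k) \<longleftrightarrow> n + m + k = 0" "k = - (n + m) \<longleftrightarrow> n + m + k = 0"
    by presburger+
  have comm: "m + (k + n) = n + (m + k)" "m + (n + k) = n + (m + k)" "k + (n + m) = n + (m + k)"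
    by presburger+
  show "hv_jac (hv_basis (X n)) (hv_basis (X m)) (hv_basis (X k)) = 0"
  proof (rule poly_mapping_eqI)
    fix j
    show "Poly_Mapping.lookup (hv_jac (hv_basis (X n)) (hv_basis (X m)) (hv_basis (X k))) j =
      Poly_Mapping.lookup 0 j"
    proof (cases "n + m + k = 0")
      case True
      then have k: "k = - n - m" by presburger
      show ?thesis by (simp add: s comm) (simp add: k field_simps power3_eq_cube)
    qed (simp add: s comm algebra_simps)
  qed
  show "hv_jac (hv_basis (X n)) (hv_basis (X m)) (hv_basis (I k)) = 0"
  proof (rule poly_mapping_eqI)
    fix j
    show "Poly_Mapping.lookup (hv_jac (hv_basis (X n)) (hv_basis (X m)) (hv_basis (I k))) j =
      Poly_Mapping.lookup 0 j"
    proof (cases "n + m + k = 0")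
      case True
      then have k: "k = - n - m" by presburger
      show ?thesis by (simp add: s comm) (simp add: k field_simps power2_eq_square)
    qed (simp add: s comm algebra_simps)
  qed
  show "hv_jac (hv_basis (X n)) (hv_basis (I m)) (hv_basis (I k)) = 0"
  proof (rule poly_mapping_eqI)
    fix j
    show "Poly_Mapping.lookup (hv_jac (hv_basis (X n)) (hv_basis (I m)) (hv_basis (I k))) j =
      Poly_Mapping.lookup 0 j"
    proof (cases "n + m + k = 0")
      case True
      then have k: "k = - n - m" by presburger
      show ?thesis by (simp add: s comm)
    qed (simp add: s comm algebra_simps)
  qed
qed

lemma hv_jac_basis_all: "hv_jac (hv_basis a) (hv_basis b) (hv_basis c) = 0"
proof -
  have 2: "hv_jac (hv_basis (X n)) (hv_basis (I k)) (hv_basis (X m)) = 0"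
    "hv_jac (hv_basis (I k)) (hv_basis (X n)) (hv_basis (X m)) = 0"
    "hv_jac (hv_basis (I k)) (hv_basis (I m)) (hv_basis (X n)) = 0"
    "hv_jac (hv_basis (I k)) (hv_basis (X n)) (hv_basis (I m)) = 0" for n m k
    using hv_jac_cyclic[of "hv_basis (X m)" "hv_basis (X n)" "hv_basis (I k)"]
      hv_jac_cyclic[of "hv_basis (I k)" "hv_basis (X m)" "hv_basis (X n)"]
      hv_jac_cyclic[of "hv_basis (I k)" "hv_basis (X n)" "hv_basis (X m)"]
      hv_jac_cyclic[of "hv_basis (X n)" "hv_basis (I k)" "hv_basis (I m)"]
      hv_jac_cyclic[of "hv_basis (I m)" "hv_basis (X n)" "hv_basis (I k)"]
      hv_jac_cyclic[of "hv_basis (I k)" "hv_basis (I m)" "hv_basis (X n)"]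
      hv_jac_cyclic[of "hv_basis (I k)" "hv_basis (X n)" "hv_basis (I m)"]
    by (simp_all add: hv_jac_basis)
  have central: "hv_bracket_basis z b = 0" "hv_bracket_basis b z = 0"
    if "z \<in> {C_D, C_DI, C_I}" for z b
    using that by (cases b; auto)+
  have central': "hv_bracket (hv_basis z) f = 0" "hv_bracket f (hv_basis z) = 0"
    if "z \<in> {C_D, C_DI, C_I}" for z f
    using that by (induction f rule: poly_mapping_basis_induct) (auto simp: hv_bracket_simps central)
  have C: "hv_jac (hv_basis z) f g = 0" if "z \<in> {C_D, C_DI, C_I}" for z f g
    using that by (simp add: hv_jac_def central' hv_bracket_simps)
  have C': "hv_jac f (hv_basis z) g = 0" "hv_jac f g (hv_basis z) = 0"
    if "z \<in> {C_D, C_DI, C_I}" for z f g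
    using C[OF that] hv_jac_cyclic by metis+
  have I: "hv_jac (hv_basis (I n)) (hv_basis (I m)) (hv_basis (I k)) = 0" for n m k
    by (simp add: hv_jac_def hv_bracket_simps)
  show ?thesis
    by (cases a; cases b; cases c) (simp_all only: hv_jac_basis 2 C C' I insert_iff simp_thms)
qed

lemma hv_jac_eq_0: "hv_jac f g h = 0"
proof (induction f rule: poly_mapping_basis_induct)
  case (single a p)
  show ?case
  proof (induction g rule: poly_mapping_basis_induct)
    case (single b q)
    show ?case
    proof (induction h rule: poly_mapping_basis_induct)
      case (single c r)
      show ?case
        using hv_jac_scale[of p "hv_basis a" q "hv_basis b" r "hv_basis c"]
        by (simp add: hv_jac_basis_all)
    next
      case (add h h')
      have "hv_jac f' g' (h + h') = hv_jac f' g' h + hv_jac f' g' h'" for f' g'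
        by (simp add: hv_jac_def hv_bracket_simps algebra_simps)
      with add show ?case by simp
    qed (simp_all add: hv_jac_def hv_bracket_simps)
  next
    case (add g g')
    have "hv_jac f' (g + g') h = hv_jac f' g h + hv_jac f' g' h" for f'
      by (simp add: hv_jac_def hv_bracket_simps algebra_simps)
    with add show ?case by simp
  qed (simp_all add: hv_jac_def hv_bracket_simps)
next
  case (add f f')
  have "hv_jac (f + f') g h = hv_jac f g h + hv_jac f' g h"
    by (simp add: hv_jac_def hv_bracket_simps algebra_simps)
  with add show ?case by simp
qed (simp_all add: hv_jac_def hv_bracket_simps)

lemma intermediate_act_simps:
  "intermediate_act \<alpha> \<beta> F (f + g) v = intermediate_act \<alpha> \<beta> F f v + intermediate_act \<alpha> \<beta> F g v"
  "intermediate_act \<alpha> \<beta> F f (v + w) = intermediate_act \<alpha> \<beta> F f v + intermediate_act \<alpha> \<beta> F f w"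
  "intermediate_act \<alpha> \<beta> F 0 v = 0" "intermediate_act \<alpha> \<beta> F f 0 = 0"
  "intermediate_act \<alpha> \<beta> F (Poly_Mapping.single a c) (Poly_Mapping.single k d) =
     fscale (c * d) (intermediate_act_basis \<alpha> \<beta> F a k)"
  by (simp_all add: intermediate_act_def bilinear_ext_add)

lemma intermediate_act_bracket:
  "intermediate_act \<alpha> \<beta> F (hv_bracket f g) v =
     intermediate_act \<alpha> \<beta> F f (intermediate_act \<alpha> \<beta> F g v)
     - intermediate_act \<alpha> \<beta> F g (intermediate_act \<alpha> \<beta> F f v)"
proof (induction f rule: poly_mapping_basis_induct)
  case (single a p)
  show ?case
  proof (induction g rule: poly_mapping_basis_induct)
    case (single b q)
    show ?case
    proof (induction v rule: poly_mapping_basis_induct)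
      case (single k r)
      show ?case
        by (cases a; cases b; rule poly_mapping_eqI;
            (simp add: hv_bracket_simps intermediate_act_simps fscale_add single_uminus[symmetric]
               lookup_add lookup_minus lookup_single when_def algebra_simps))
    qed (simp_all add: hv_bracket_simps intermediate_act_simps)
  qed (simp_all add: hv_bracket_simps intermediate_act_simps)
qed (simp_all add: hv_bracket_simps intermediate_act_simps)

theorem complex_lie_algebra_hv: "complex_lie_algebra fscale hv_bracket"
  unfolding complex_lie_algebra_def complex_lie_algebra_axioms_def
proof (intro conjI allI)
  fix f g h :: hv
  show "vector_space (fscale :: complex \<Rightarrow> hv \<Rightarrow> hv)" by (rule vector_space_fscale)
  show "Vector_Spaces.linear fscale fscale (\<lambda>f. hv_bracket f g)"
    "Vector_Spaces.linear fscale fscale (hv_bracket f)"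
    unfolding hv_bracket_def by (rule linear_bilinear_ext)+
  have "hv_bracket f f = - hv_bracket f f" by (rule hv_bracket_antisym)
  then have "Poly_Mapping.lookup (hv_bracket f f) k = - Poly_Mapping.lookup (hv_bracket f f) k" for k
    by (metis lookup_uminus)
  then show "hv_bracket f f = 0" by (intro poly_mapping_eqI) (simp add: eq_neg_iff_add_eq_0)
  show "hv_bracket f (hv_bracket g h) + hv_bracket g (hv_bracket h f) + hv_bracket h (hv_bracket f g) = 0"
    using hv_jac_eq_0[of f g h] by (simp add: hv_jac_def)
qed

theorem hv_module_intermediate: "hv_module fscale (intermediate_act \<alpha> \<beta> F)"
  unfolding lie_module_def lie_module_axioms_def
  by (intro conjI allI complex_lie_algebra_hv vector_space_fscale intermediate_act_bracket)
    (unfold intermediate_act_def, (rule linear_bilinear_ext)+)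

theorem submodule_V_prime: "submodule fscale (intermediate_act 0 1 0) V_prime"
proof -
  interpret V: vector_space "fscale :: complex \<Rightarrow> (int \<Rightarrow>\<^sub>0 complex) \<Rightarrow> _"
    by (rule vector_space_fscale)
  have sub: "V.subspace V_prime"
    unfolding V_prime_def by (rule V.subspace_span)
  note closed = V.subspace_0[OF sub] V.subspace_add[OF sub] V.subspace_scale[OF sub]
  have in_V_prime: "Poly_Mapping.single j d \<in> V_prime" if "d = 0 \<or> j \<noteq> 0" for d j
  proof (cases "d = 0")
    case False
    with that have "Poly_Mapping.single j 1 \<in> V_prime"
      unfolding V_prime_def by (intro V.span_base) auto
    from closed(3)[OF this, of d] show ?thesis by simp
  qed (simp add: closed)
  have basis: "intermediate_act 0 1 0 x (Poly_Mapping.single k 1) \<in> V_prime" if "k \<noteq> 0" for x k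
  proof (induction x rule: poly_mapping_basis_induct)
    case (single a c)
    show ?case
    proof (cases a)
      case (X i)
      have "complex_of_int k + complex_of_int i = 0" if "i + k = 0"
        using that by (metis add.commute of_int_0 of_int_add)
      then have "c * (of_int k + of_int i) = 0 \<or> i + k \<noteq> 0" by auto
      from in_V_prime[OF this] show ?thesis using X by (simp add: intermediate_act_simps)
    qed (simp_all add: intermediate_act_simps closed)
  qed (simp_all add: intermediate_act_simps closed)
  have "intermediate_act 0 1 0 x v \<in> V_prime" if "v \<in> V_prime" for x v
    using that[unfolded V_prime_def]
  proof (induction rule: V.span_induct_alt)
    case base
    show ?case by (simp add: intermediate_act_simps closed)
  next
    case (step c w v)
    then have "intermediate_act 0 1 0 x w \<in> V_prime" using basis by blast
    then have "fscale c (intermediate_act 0 1 0 x w) + intermediate_act 0 1 0 x v \<in> V_prime"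
      using step by (intro closed)
    then show ?case
      by (simp add: intermediate_act_def bilinear_ext_add bilinear_ext_scale_right)
  qed
  with sub show ?thesis by (simp add: submodule_def)
qed

end

theory Submission
  imports Defs "HOL-Computational_Algebra.Polynomial"
begin

text \<open>
  All weights of \<open>V\<close> lie in one coset \<open>\<alpha> + \<int>\<close> and the central elements and \<open>I(0)\<close> act by scalars. By
  the representation theory of \<open>\<langle>x\<^sub>-\<^sub>1, x\<^sub>0, x\<^sub>1\<rangle>\<close> a gap in the support is only possible where the
  weight has the right sign, so the support contains a half line unless it is finite, and a finite
  support forces \<open>V\<close> to be trivial. On a half line where \<open>x\<^sub>-\<^sub>1x\<^sub>1\<close> does not vanish, normalise
  \<open>x\<^sub>1v\<^sub>k = v\<^sub>k\<^sub>+\<^sub>1\<close>; the coefficients of \<open>x\<^sub>-\<^sub>1, x\<^sub>\<plusminus>\<^sub>2, I(\<plusminus>1)\<close> then satisfy difference equations whose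
  solutions are quotients of polynomials, and comparing coefficients shows that the central charges
  vanish and that the half line looks like the one of some \<open>V(\<alpha>,\<beta>;F)\<close>, where one may take \<open>\<beta> \<noteq> 0\<close> or
  \<open>F \<noteq> 0\<close>. Finally a vector is determined by its images under \<open>x\<^sub>i\<close> and \<open>I(i)\<close> for large \<open>i\<close>, which lie on
  that half line; comparing these images embeds \<open>V\<close> into \<open>V(\<alpha>,\<beta>;F)\<close> with an image that misses at most
  one basis vector.
\<close>

section \<open>Difference equations on a half line\<close>

text \<open>The recurrences only give polynomial identities at the points of an arithmetic
  progression. These are infinitely many roots, so all coefficients may be compared.\<close>

lemma poly_eq_0_if_progression_roots:
  fixes p :: "complex poly"
  assumes "a \<noteq> 0" and "\<And>j::nat. poly p (b + a * of_nat j) = 0"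
  shows "p = 0"
proof (rule ccontr)
  assume "p \<noteq> 0"
  then have "finite {x. poly p x = 0}" by (rule poly_roots_finite)
  moreover have "range (\<lambda>j::nat. b + a * of_nat j) \<subseteq> {x. poly p x = 0}"
    using assms(2) by auto
  moreover have "inj (\<lambda>j::nat. b + a * of_nat j)"
    using assms(1) by (auto intro!: injI)
  ultimately show False
    using finite_subset range_inj_infinite by blast
qed

lemma telescope_nat:
  fixes h p :: "nat \<Rightarrow> 'a::ab_group_add"
  assumes "\<And>k. h (Suc k) - h k = p (Suc k) - p k"
  shows "h k = p k + (h 0 - p 0)"
proof (induction k)
  case (Suc k)
  have "h (Suc k) = h k + (p (Suc k) - p k)" using assms[of k] by (simp add: algebra_simps)
  with Suc show ?case by simp
qed simp

text \<open>In a basis with \<open>x\<^sub>1v\<^sub>k = v\<^sub>k\<^sub>+\<^sub>1\<close> and \<open>x\<^sub>0v\<^sub>k = (\<mu> + k)v\<^sub>k\<close>, the functions \<open>f\<close>, \<open>s\<close>, \<open>t\<close>, \<open>q\<close>, \<open>u\<close> are the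
  coefficients of \<open>x\<^sub>-\<^sub>1\<close>, \<open>x\<^sub>2\<close>, \<open>x\<^sub>-\<^sub>2\<close>, \<open>I(1)\<close>, \<open>I(-1)\<close>, each indexed by the smaller of the two basis indices
  involved. The recurrences express the brackets \<open>[x\<^sub>-\<^sub>1,x\<^sub>2]\<close>, \<open>[x\<^sub>1,x\<^sub>-\<^sub>2]\<close>, \<open>[x\<^sub>2,x\<^sub>-\<^sub>2]\<close>, \<open>[x\<^sub>-\<^sub>1,I(1)]\<close>,
  \<open>[x\<^sub>1,I(-1)]\<close>, \<open>[x\<^sub>-\<^sub>2,I(1)]\<close>, \<open>[I(1),I(-1)]\<close> in this order.\<close>

locale germ_coefficients =
  fixes f s t q u :: "nat \<Rightarrow> complex" and \<mu> \<phi> F c d e :: complex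
  assumes f: "f k = (\<mu> + of_nat k) * (\<mu> + of_nat k + 1) + \<phi>"
    and f_nz: "f k \<noteq> 0"
    and s_rec: "s (Suc k) * f (Suc (Suc k)) - s k * f k = 3"
    and t_rec: "t k - t (Suc k) = - 3 * f (Suc k)"
    and st_rec: "t k * s k - s (Suc (Suc k)) * t (Suc (Suc k)) = - 4 * (\<mu> + of_nat k + 2) + c / 2"
    and q_rec: "q (Suc k) * f (Suc k) - q k * f k = F"
    and u_rec: "u k - u (Suc k) = - F + 2 * d"
    and tq_rec: "q (Suc (Suc k)) * t (Suc k) - t k * q k = u (Suc k)"
    and qu_rec: "u k * q k - q (Suc k) * u (Suc k) = e"
begin

text \<open>The shift centres the variable between k and k + 1: \<open>f k\<close> and
  \<open>f (Suc k)\<close> become y^2 - y + \<phi> and y^2 + y + \<phi>, which are exchanged by y ->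
  -y.\<close>

abbreviation y :: "nat \<Rightarrow> complex" where "y k \<equiv> \<mu> + of_nat k + 1"

text \<open>Multiplied by \<open>f (Suc k)\<close>, \<open>s_rec\<close> says that the left-hand
  side has first difference \<open>3 * f (Suc k)\<close>. This is quadratic in y, and the cubic is
  its antidifference.\<close>

lemma s_closed: "\<exists>\<sigma>. \<forall>k. s k * f k * f (Suc k) = y k ^ 3 + (3 * \<phi> - 1) * y k + \<sigma>"
proof -
  let ?h = "\<lambda>k. s k * f k * f (Suc k)" and ?p = "\<lambda>k. y k ^ 3 + (3 * \<phi> - 1) * y k"
  have "?h (Suc k) - ?h k = ?p (Suc k) - ?p k" for k
  proof -
    have "?h (Suc k) - ?h k = (s (Suc k) * f (Suc (Suc k)) - s k * f k) * f (Suc k)"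
      by (simp add: algebra_simps)
    also have "\<dots> = 3 * f (Suc k)" by (simp add: s_rec)
    also have "\<dots> = ?p (Suc k) - ?p k" by (simp add: f power3_eq_cube algebra_simps)
    finally show ?thesis .
  qed
  from telescope_nat[of ?h ?p, OF this] show ?thesis by blast
qed

lemma t_closed: "\<exists>\<tau>. \<forall>k. t k = y k ^ 3 + (3 * \<phi> - 1) * y k + \<tau>"
proof -
  let ?p = "\<lambda>k. y k ^ 3 + (3 * \<phi> - 1) * y k"
  have "t (Suc k) - t k = ?p (Suc k) - ?p k" for k
  proof -
    have "t (Suc k) - t k = 3 * f (Suc k)" using t_rec[of k] by (simp add: algebra_simps)
    also have "\<dots> = ?p (Suc k) - ?p k" by (simp add: f power3_eq_cube algebra_simps)
    finally show ?thesis .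
  qed
  from telescope_nat[of t ?p, OF this] show ?thesis by blast
qed

text \<open>\<open>st_rec\<close> links indices two apart, so it is summed along even indices with a
  single constant. Such a progression still determines a polynomial.\<close>

lemma st_closed: "\<exists>\<gamma>. \<forall>j. s (2*j) * t (2*j) = y (2*j) ^ 2 - c / 4 * y (2*j) + \<gamma>"
proof -
  let ?h = "\<lambda>j. s (2*j) * t (2*j)" and ?p = "\<lambda>j. y (2*j) ^ 2 - c / 4 * y (2*j)"
  have "?h (Suc j) - ?h j = ?p (Suc j) - ?p j" for j
  proof -
    have "?h (Suc j) - ?h j = 4 * (\<mu> + of_nat (2*j) + 2) - c / 2"
      using st_rec[of "2*j"] by (simp add: field_simps)
    also have "\<dots> = ?p (Suc j) - ?p j" by (simp add: power2_eq_square field_simps)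
    finally show ?thesis .
  qed
  from telescope_nat[of ?h ?p, OF this] show ?thesis by blast
qed

lemma q_closed: "\<exists>\<kappa>. \<forall>k. q k * f k = F * y k + \<kappa>"
proof -
  have "q (Suc k) * f (Suc k) - q k * f k = F * y (Suc k) - F * y k" for k
    using q_rec[of k] by (simp add: algebra_simps)
  from telescope_nat[of "\<lambda>k. q k * f k" "\<lambda>k. F * y k", OF this] show ?thesis by blast
qed

lemma u_closed: "\<exists>\<upsilon>. \<forall>k. u k = (F - 2 * d) * y k + \<upsilon>"
proof -
  have "u (Suc k) - u k = (F - 2 * d) * y (Suc k) - (F - 2 * d) * y k" for k
    using u_rec[of k] by (simp add: algebra_simps)
  from telescope_nat[of u "\<lambda>k. (F - 2 * d) * y k", OF this] show ?thesis by blast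
qed

lemma qu_closed: "\<exists>\<epsilon>. \<forall>k. q k * u k = - e * y k + \<epsilon>"
proof -
  have "q (Suc k) * u (Suc k) - q k * u k = - e * y (Suc k) - - e * y k" for k
    using qu_rec[of k] by (simp add: algebra_simps)
  from telescope_nat[of "\<lambda>k. q k * u k" "\<lambda>k. - e * y k", OF this] show ?thesis by blast
qed

section \<open>Elimination of the constants of summation\<close>

lemma f_y: "f k = y k ^ 2 - y k + \<phi>" "f (Suc k) = y k ^ 2 + y k + \<phi>"
  by (simp_all add: f power2_eq_square algebra_simps)

text \<open>The product \<open>s k * t k * f k * f (Suc k)\<close> can be grouped in two ways. At
  even k every group has a known polynomial form, and comparing coefficients yields c = 0, \<tau> =
  -\<sigma> and \<sigma>^2 = (1 - 4\<phi>)\<phi>^2. A square root of 1 - 4\<phi> is then 2\<beta> -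
  1.\<close>

lemma virasoro_part:
  obtains \<beta> where "c = 0" "\<phi> = \<beta> * (1 - \<beta>)"
    "\<And>k. s k * f k * f (Suc k) = y k ^ 3 + (3 * \<phi> - 1) * y k - (2 * \<beta> - 1) * \<phi>"
    "\<And>k. t k = y k ^ 3 + (3 * \<phi> - 1) * y k + (2 * \<beta> - 1) * \<phi>"
proof -
  obtain \<sigma> \<tau> \<gamma> where S: "\<And>k. s k * f k * f (Suc k) = y k ^ 3 + (3 * \<phi> - 1) * y k + \<sigma>"
    and T: "\<And>k. t k = y k ^ 3 + (3 * \<phi> - 1) * y k + \<tau>"
    and G: "\<And>j. s (2*j) * t (2*j) = y (2*j) ^ 2 - c / 4 * y (2*j) + \<gamma>"
    using s_closed t_closed st_closed by blast
  let ?A = "3 * \<phi> - 1"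
  \<comment> \<open>The difference of the two sextics in y: the leading terms cancel, and the
    coefficient c / 4 of degree five comes to the top.\<close>
  let ?P = "[: \<sigma> * \<tau> - \<gamma> * \<phi>^2, ?A * (\<sigma> + \<tau>) + c / 4 * \<phi>^2, ?A^2 - \<phi>^2 - \<gamma> * (2 * \<phi> - 1),
     \<sigma> + \<tau> + c / 4 * (2 * \<phi> - 1), 2 * ?A - (2 * \<phi> - 1) - \<gamma>, c / 4 :]"
  have "poly ?P (\<mu> + 1 + 2 * of_nat j) = 0" for j
  proof -
    define z where "z = y (2*j)"
    have z: "\<mu> + 1 + 2 * of_nat j = z" by (simp add: z_def)
    have "(z^3 + ?A * z + \<sigma>) * (z^3 + ?A * z + \<tau>) = (s (2*j) * f (2*j) * f (Suc (2*j))) * t (2*j)"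
      unfolding S T z_def ..
    also have "\<dots> = (s (2*j) * t (2*j)) * (f (2*j) * f (Suc (2*j)))" by simp
    also have "\<dots> = (z^2 - c / 4 * z + \<gamma>) * ((z^2 - z + \<phi>) * (z^2 + z + \<phi>))"
      unfolding G f_y(1)[of "2*j"] f_y(2)[of "2*j"] z_def ..
    finally have "(z^3 + ?A * z + \<sigma>) * (z^3 + ?A * z + \<tau>) =
        (z^2 - c / 4 * z + \<gamma>) * ((z^2 - z + \<phi>) * (z^2 + z + \<phi>))" .
    then have "(z^3 + ?A * z + \<sigma>) * (z^3 + ?A * z + \<tau>) -
        (z^2 - c / 4 * z + \<gamma>) * ((z^2 - z + \<phi>) * (z^2 + z + \<phi>)) = 0" by simp
    moreover have "poly ?P z = (z^3 + ?A * z + \<sigma>) * (z^3 + ?A * z + \<tau>) -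
        (z^2 - c / 4 * z + \<gamma>) * ((z^2 - z + \<phi>) * (z^2 + z + \<phi>))"
      by (simp add: power2_eq_square power3_eq_cube algebra_simps)
    ultimately show ?thesis unfolding z by simp
  qed
  then have "?P = 0" by (intro poly_eq_0_if_progression_roots[of 2 ?P "\<mu> + 1"]) auto
  then have c0: "c = 0" and "\<sigma> + \<tau> = 0" and "\<gamma> = 4 * \<phi> - 1" and "\<sigma> * \<tau> = \<gamma> * \<phi>^2"
    by (auto simp: pCons_eq_0_iff)
  then have st: "\<tau> = - \<sigma>" and "\<sigma> * \<tau> = (4 * \<phi> - 1) * \<phi>^2"
    by (simp_all add: eq_neg_iff_add_eq_0 add.commute)
  then have sq: "\<sigma>^2 = (1 - 4 * \<phi>) * \<phi>^2" by algebra
  define r where "r = csqrt (1 - 4 * \<phi>)"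
  have r2: "r^2 = 1 - 4 * \<phi>" by (simp add: r_def)
  have "\<sigma>^2 = (r * \<phi>)^2" by (simp add: sq r2 power_mult_distrib)
  then have "\<sigma> = r * \<phi> \<or> \<sigma> = - (r * \<phi>)" by (simp only: power2_eq_iff)
  \<comment> \<open>The root is taken with the sign that gives \<sigma> = -r' \<phi>; changing the
    sign would exchange \<beta> and 1 - \<beta>.\<close>
  then obtain r' where r': "r'^2 = 1 - 4 * \<phi>" "\<sigma> = - (r' * \<phi>)"
    using r2 by (metis minus_mult_left minus_minus power2_minus)
  have ph: "\<phi> = (1 - r'^2) / 4" by (simp add: r')
  show thesis
  proof (rule that[of "(1 + r') / 2"])
    show "\<phi> = (1 + r') / 2 * (1 - (1 + r') / 2)"
      unfolding ph by (simp add: power2_eq_square field_simps)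
    have "2 * ((1 + r') / 2) - 1 = r'" by (simp add: field_simps)
    then show "t k = y k ^ 3 + ?A * y k + (2 * ((1 + r') / 2) - 1) * \<phi>"
      "s k * f k * f (Suc k) = y k ^ 3 + ?A * y k - (2 * ((1 + r') / 2) - 1) * \<phi>" for k
      by (simp_all add: S T st r')
  qed (fact c0)
qed

text \<open>The remaining constants come from evaluating a polynomial identity at well-chosen
  points. If \<phi> = 0, then \<beta> is 0 or 1 and the formulas for \<open>f\<close> and
  \<open>t\<close> do not tell these values apart, so \<open>I(1)\<close> and \<open>I(-1)\<close>
  may select the other one: the second alternative is the first with 1 - \<beta> for
  \<beta>.\<close>

lemma heisenberg_part:
  assumes ph: "\<phi> = \<beta> * (1 - \<beta>)"
    and T: "\<And>k. t k = y k ^ 3 + (3 * \<phi> - 1) * y k + (2 * \<beta> - 1) * \<phi>"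
  obtains "d = 0" "e = 0" "\<And>k. q k * f k = F * (y k - \<beta>)" "\<And>k. u k = F * (y k - 1 + \<beta>)"
  | "\<phi> = 0" "d = 0" "e = 0" "\<And>k. q k * f k = F * (y k - 1 + \<beta>)" "\<And>k. u k = F * (y k - \<beta>)"
proof -
  obtain \<kappa>' \<upsilon>' \<epsilon> where Q': "\<And>k. q k * f k = F * y k + \<kappa>'"
    and U': "\<And>k. u k = (F - 2 * d) * y k + \<upsilon>'" and QU: "\<And>k. q k * u k = - e * y k + \<epsilon>"
    using q_closed u_closed qu_closed by blast
  define \<kappa> where "\<kappa> = \<kappa>' + F * \<beta>"
  define D where "D = F - 2 * d"
  define \<upsilon> where "\<upsilon> = \<upsilon>' + D"
  have Q: "q k * f k = F * (y k - \<beta>) + \<kappa>" for k unfolding Q' \<kappa>_def by (simp add: algebra_simps)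
  have U: "u k = D * (y k - 1) + \<upsilon>" for k unfolding U' D_def \<upsilon>_def by (simp add: algebra_simps)
  have f\<beta>: "f k = (y k - 1 + \<beta>) * (y k - \<beta>)" for k
    by (simp add: f ph algebra_simps)
  have t\<beta>: "t k = (y k + 1 - 2 * \<beta>) * (y k - 1 + \<beta>) * (y k + \<beta>)" for k
    unfolding T ph by (simp add: power3_eq_cube algebra_simps)
  \<comment> \<open>This is \<open>tq_rec\<close> multiplied by
    \<open>f k * f (Suc (Suc k))\<close>, written in z = \<open>y (Suc k)\<close> and divided by the
    nonvanishing factor (z + \<beta>)(z - 2 + \<beta>).\<close>
  let ?lhs = "\<lambda>z. (F * (z + 1 - \<beta>) + \<kappa>) * (z + 1 - 2 * \<beta>) * (z - 1 + \<beta>) * (z - 1 - \<beta>)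
     - (F * (z - 1 - \<beta>) + \<kappa>) * (z - 2 * \<beta>) * (z - 1 + \<beta>) * (z + 1 - \<beta>)
     - (D * (z - 1) + \<upsilon>) * (z + 1 - \<beta>) * (z - 1 - \<beta>)"
  let ?b = "1 - \<beta>"
  let ?P1 = "[:1 - 2 * \<beta>, 1:] * [: - ?b, 1:] * [: - 1 - \<beta>, 1:] * [:F * ?b + \<kappa>, F:]
     - [:- 2 * \<beta>, 1:] * [: - ?b, 1:] * [: ?b, 1:] * [:F * (- 1 - \<beta>) + \<kappa>, F:]
     - [: \<upsilon> - D, D:] * [: ?b, 1:] * [: - 1 - \<beta>, 1:]"
  have P1: "poly ?P1 z = ?lhs z" for z by (simp add: algebra_simps)
  have "poly ?P1 (\<mu> + 2 + 1 * of_nat k) = 0" for k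
  proof -
    define z where "z = y (Suc k)"
    have z: "\<mu> + 2 + 1 * of_nat k = z" "y k = z - 1" "y (Suc k) = z" "y (Suc (Suc k)) = z + 1"
      by (simp_all add: z_def)
    have nz: "z + \<beta> \<noteq> 0" "z - 2 + \<beta> \<noteq> 0" 
      using f_nz[of k] f_nz[of "Suc (Suc k)"] unfolding f\<beta> z by auto
    have "(q (Suc (Suc k)) * f (Suc (Suc k))) * t (Suc k) * f k - t k * (q k * f k) * f (Suc (Suc k))
       - u (Suc k) * f k * f (Suc (Suc k)) = 0"
      unfolding tq_rec[symmetric] by (simp add: algebra_simps)
    then have "(F * (z + 1 - \<beta>) + \<kappa>) * ((z + 1 - 2 * \<beta>) * (z - 1 + \<beta>) * (z + \<beta>)) * ((z - 2 + \<beta>) * (z - 1 - \<beta>))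
      - ((z - 2 * \<beta>) * (z - 2 + \<beta>) * (z - 1 + \<beta>)) * (F * (z - 1 - \<beta>) + \<kappa>) * ((z + \<beta>) * (z + 1 - \<beta>))
      - (D * (z - 1) + \<upsilon>) * ((z - 2 + \<beta>) * (z - 1 - \<beta>)) * ((z + \<beta>) * (z + 1 - \<beta>)) = 0"
      unfolding Q t\<beta> U unfolding f\<beta> z by (simp add: algebra_simps)
    then have "(z + \<beta>) * (z - 2 + \<beta>) * ?lhs z = 0" by (simp add: algebra_simps)
    with nz have "?lhs z = 0" by simp
    then show ?thesis unfolding z(1) P1 .
  qed
  then have "?P1 = 0" by (intro poly_eq_0_if_progression_roots[of 1 ?P1 "\<mu> + 2"]) auto
  with P1 have L: "?lhs z = 0" for z by (metis poly_0)
  \<comment> \<open>The product of \<open>q k\<close>, \<open>u k\<close> and \<open>f k\<close> is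
    grouped in two ways. One grouping is at most quadratic in y, the other has cubic coefficient -e,
    hence e = 0.\<close>
  let ?P2 = "[:\<kappa> - F * \<beta>, F:] * [:\<upsilon> - D, D:] - [:\<epsilon>, - e:] * [:\<phi>, - 1, 1:]"
  have "poly ?P2 (\<mu> + 1 + 1 * of_nat k) = 0" for k
  proof -
    have z: "\<mu> + 1 + 1 * of_nat k = y k" by simp
    have "(q k * f k) * u k - (q k * u k) * f k = 0" by simp
    then have "(F * (y k - \<beta>) + \<kappa>) * (D * (y k - 1) + \<upsilon>) - (- e * y k + \<epsilon>) * (y k ^ 2 - y k + \<phi>) = 0"
      unfolding QU unfolding Q U unfolding f_y .
    then show ?thesis unfolding z by (simp add: power2_eq_square algebra_simps)
  qed
  then have P2: "?P2 = 0" by (intro poly_eq_0_if_progression_roots[of 1 ?P2 "\<mu> + 1"]) auto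
  have e0: "e = 0" and FD: "F * D = \<epsilon>" and k0: "(\<kappa> - F * \<beta>) * (\<upsilon> - D) = \<epsilon> * \<phi>"
    using P2 by (auto simp: algebra_simps)
  \<comment> \<open>At z = \<beta> - 1 the factor z + 1 - \<beta> kills the second and the third
    term, which isolates \<kappa>.\<close>
  have "?lhs (\<beta> - 1) = 0" by (rule L)
  then have "\<kappa> * \<beta> * (\<beta> - 1) = 0" by (simp add: algebra_simps)
  then consider "\<kappa> = 0" | "\<kappa> \<noteq> 0" "\<beta> = 0" | "\<kappa> \<noteq> 0" "\<beta> = 1" by auto
  then show thesis
  proof cases
    case 1
    have "F * (2 * \<beta> - 1) = D * (\<beta> - 1) + \<upsilon>"
      using L[of \<beta>] 1 by (simp add: algebra_simps)
    moreover have "3 * (F * (2 * \<beta> + 1)) = 3 * (D * (\<beta> + 1) + \<upsilon>)"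
      using L[of "\<beta> + 2"] 1 by (simp add: algebra_simps)
    then have "F * (2 * \<beta> + 1) = D * (\<beta> + 1) + \<upsilon>"
      by (metis mult_cancel_left zero_neq_numeral)
    ultimately have *: "F * (2 * \<beta> - 1) = D * (\<beta> - 1) + \<upsilon>" "F * (2 * \<beta> + 1) = D * (\<beta> + 1) + \<upsilon>"
      by blast+
    have "2 * D = 2 * F" using *[symmetric] by algebra
    then have D: "D = F" by simp
    with *(1) have "\<upsilon> = F * \<beta>" by algebra
    with 1 D e0 Q U show thesis by (intro that(1)) (simp_all add: D_def algebra_simps)
  next
    case 2
    have *: "F + \<kappa> + \<upsilon> - D = 0" "3 * (F - \<kappa>) = 3 * (D + \<upsilon>)"
      using L[of 0] L[of 2] 2 by (simp_all add: algebra_simps)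
    then have "2 * D = 2 * F" by algebra
    then have D: "D = F" by simp
    moreover from * D have "\<upsilon> = - \<kappa>" by algebra
    ultimately have D: "D = F" "\<upsilon> = - \<kappa>" by auto
    have "\<phi> = 0" using 2 ph by simp
    with k0 2 D have "\<kappa> * (\<kappa> + F) = 0" by algebra
    with 2 have "\<kappa> = - F" by (simp add: eq_neg_iff_add_eq_0)
    with 2 D e0 Q U ph show thesis by (intro that(2)) (simp_all add: D_def algebra_simps)
  next
    case 3
    have *: "\<upsilon> = F - \<kappa>"
      using L[of 1] 3 by (simp add: algebra_simps)
    have "3 * (2 * D) = 3 * (\<kappa> + F + \<upsilon>)"
      using L[of "- 1"] 3 by (simp add: algebra_simps)
    with * have "2 * D = 2 * F" by algebra
    with * have D: "D = F" "\<upsilon> = F - \<kappa>" by auto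
    with k0 3 ph have "\<kappa> = F" by (simp add: algebra_simps)
    with 3 D e0 Q U ph show thesis by (intro that(2)) (simp_all add: D_def algebra_simps)
  qed
qed

text \<open>The normal form is the action of $V(\alpha,\beta;F)$ in the basis normalised by
  $x_1 v_k = v_{k+1}$. For $F = 0$ the parameters $\beta = 0$ and $\beta = 1$ give the same
  coefficients, and $\beta = 1$ is preferred.\<close>

lemma normal_form:
  obtains \<beta> where "c = 0" "d = 0" "e = 0" "\<beta> \<noteq> 0 \<or> F \<noteq> 0"
    "\<And>k. \<mu> + of_nat k + \<beta> \<noteq> 0"
    "\<And>k. f k = (\<mu> + of_nat k + \<beta>) * (\<mu> + of_nat k + 1 - \<beta>)"
    "\<And>k. s k * ((\<mu> + of_nat k + \<beta>) * (\<mu> + of_nat k + 1 + \<beta>)) = \<mu> + of_nat k + 2 * \<beta>"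
    "\<And>k. t k = (\<mu> + of_nat k + 2 - 2 * \<beta>) * ((\<mu> + of_nat k + \<beta>) * (\<mu> + of_nat k + 1 + \<beta>))"
    "\<And>k. q k * (\<mu> + of_nat k + \<beta>) = F"
    "\<And>k. u k = F * (\<mu> + of_nat k + \<beta>)"
proof -
  obtain \<beta>' where c0: "c = 0" and ph': "\<phi> = \<beta>' * (1 - \<beta>')"
    and S': "\<And>k. s k * f k * f (Suc k) = y k ^ 3 + (3 * \<phi> - 1) * y k - (2 * \<beta>' - 1) * \<phi>"
    and T': "\<And>k. t k = y k ^ 3 + (3 * \<phi> - 1) * y k + (2 * \<beta>' - 1) * \<phi>"
    using virasoro_part by blast
  have "\<exists>\<beta>. d = 0 \<and> e = 0 \<and> \<phi> = \<beta> * (1 - \<beta>) \<and> (2 * \<beta> - 1) * \<phi> = (2 * \<beta>' - 1) * \<phi>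
      \<and> (\<forall>k. q k * f k = F * (y k - \<beta>)) \<and> (\<forall>k. u k = F * (y k - 1 + \<beta>))"
  proof (rule heisenberg_part[OF ph' T'], goal_cases)
    case 1
    with ph' show ?case by (intro exI[of _ \<beta>']) simp
  next
    case 2
    \<comment> \<open>Here \<phi> = 0, so passing to 1 - \<beta>' changes neither \<phi> nor
      (2\<beta>' - 1)\<phi>, and the formulas for \<open>s\<close> and \<open>t\<close>
      survive.\<close>
    with ph' show ?case by (intro exI[of _ "1 - \<beta>'"]) (simp add: algebra_simps)
  qed
  then obtain \<beta>1 where d0: "d = 0" "e = 0" and ph1: "\<phi> = \<beta>1 * (1 - \<beta>1)"
      "(2 * \<beta>1 - 1) * \<phi> = (2 * \<beta>' - 1) * \<phi>"
    and Q1: "\<And>k. q k * f k = F * (y k - \<beta>1)" and U1: "\<And>k. u k = F * (y k - 1 + \<beta>1)"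
    by blast
  define \<beta> where "\<beta> = (if \<beta>1 = 0 \<and> F = 0 then 1 else \<beta>1)"
  have ph: "\<phi> = \<beta> * (1 - \<beta>)" "(2 * \<beta> - 1) * \<phi> = (2 * \<beta>' - 1) * \<phi>"
    using ph1 by (auto simp: \<beta>_def)
  have Q: "q k * f k = F * (y k - \<beta>)" and U: "u k = F * (y k - 1 + \<beta>)" for k
    using Q1[of k] U1[of k] by (auto simp: \<beta>_def)
  have fb: "f k = (\<mu> + of_nat k + \<beta>) * (\<mu> + of_nat k + 1 - \<beta>)" for k
    by (simp add: f ph(1) algebra_simps)
  have nz: "\<mu> + of_nat k + \<beta> \<noteq> 0" "\<mu> + of_nat k + 1 - \<beta> \<noteq> 0" for k
    using f_nz[of k] by (auto simp: fb)
  show thesis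
  proof (rule that[OF c0 d0 _ nz(1) fb])
    show "\<beta> \<noteq> 0 \<or> F \<noteq> 0" by (simp add: \<beta>_def)
    fix k
    let ?m = "\<mu> + of_nat k"
    have nz': "?m + 1 + \<beta> \<noteq> 0" "?m + 2 - \<beta> \<noteq> 0" 
      using nz(1)[of "Suc k"] nz(2)[of "Suc k"] by (simp_all add: algebra_simps)
    have fS: "f (Suc k) = (?m + 1 + \<beta>) * (?m + 2 - \<beta>)"
      by (simp add: fb algebra_simps)
    have "(s k * ((?m + \<beta>) * (?m + 1 + \<beta>))) * ((?m + 1 - \<beta>) * (?m + 2 - \<beta>)) = s k * f k * f (Suc k)"
      unfolding fS unfolding fb by simp
    also have "\<dots> = (?m + 2 * \<beta>) * ((?m + 1 - \<beta>) * (?m + 2 - \<beta>))"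
      unfolding S' ph(2)[symmetric] unfolding ph(1) by (simp add: power3_eq_cube algebra_simps)
    finally show "s k * ((?m + \<beta>) * (?m + 1 + \<beta>)) = ?m + 2 * \<beta>"
      using nz(2)[of k] nz'(2) by simp
    show "t k = (?m + 2 - 2 * \<beta>) * ((?m + \<beta>) * (?m + 1 + \<beta>))"
      unfolding T' ph(2)[symmetric] unfolding ph(1) by (simp add: power3_eq_cube algebra_simps)
    have "(q k * (?m + \<beta>)) * (?m + 1 - \<beta>) = F * (?m + 1 - \<beta>)"
      using Q[of k] unfolding fb by (simp add: algebra_simps)
    then show "q k * (?m + \<beta>) = F" using nz(2)[of k] by simp
    show "u k = F * (?m + \<beta>)" unfolding U by simp
  qed
qed

end


section \<open>Supports of weight modules with multiplicity one\<close>

text \<open>\<open>L i\<close> and \<open>H i\<close> are the actions of \<open>x\<^sub>i\<close> and \<open>I(i)\<close>; the scalars \<open>c\<close>, \<open>d\<close>, \<open>e\<close>, \<open>F\<close> are those by which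
  \<open>C\<^sub>D\<close>, \<open>C\<^sub>D\<^sub>I\<close>, \<open>C\<^sub>I\<close>, \<open>I(0)\<close> act.\<close>

locale hv_weight_rep = vector_space scale
  for scale :: "complex \<Rightarrow> 'v::ab_group_add \<Rightarrow> 'v" +
  fixes L H :: "int \<Rightarrow> 'v \<Rightarrow> 'v" and c d e F \<alpha> :: complex
  assumes linear_L: "Vector_Spaces.linear scale scale (L i)"
    and linear_H: "Vector_Spaces.linear scale scale (H i)"
    and LL: "L i (L j v) = L j (L i v) + scale (of_int (j - i)) (L (i + j) v)
      + scale (if i = - j then (of_int i ^ 3 - of_int i) / 12 * c else 0) v"
    and LH: "L i (H j v) = H j (L i v) + scale (of_int j) (H (i + j) v)
      + scale (if i = - j then (of_int i ^ 2 + of_int i) * d else 0) v"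
    and HH: "H i (H j v) = H j (H i v) + scale (if i = - j then of_int i * e else 0) v"
    and H_0: "H 0 v = scale F v"
    and irreducible: "subspace U \<Longrightarrow> (\<And>i v. v \<in> U \<Longrightarrow> L i v \<in> U) \<Longrightarrow> (\<And>i v. v \<in> U \<Longrightarrow> H i v \<in> U)
      \<Longrightarrow> U = {0} \<or> U = UNIV"
    and multiplicity_one: "L 0 u = scale (\<alpha> + of_int n) u \<Longrightarrow> L 0 v = scale (\<alpha> + of_int n) v \<Longrightarrow> u \<noteq> 0
      \<Longrightarrow> \<exists>a. v = scale a u"
    and spanning: "span {v. \<exists>n. L 0 v = scale (\<alpha> + of_int n) v} = UNIV"
    and nontrivial: "\<exists>i v. L i v \<noteq> 0 \<or> H i v \<noteq> 0"
begin

lemma L_linear: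
  "L i (u + v) = L i u + L i v" "L i (scale a v) = scale a (L i v)" "L i 0 = 0"
  "L i (- v) = - L i v" "L i (u - v) = L i u - L i v"
proof -
  interpret l: Vector_Spaces.linear scale scale "L i" by (rule linear_L)
  show "L i (u + v) = L i u + L i v" "L i (scale a v) = scale a (L i v)" "L i 0 = 0"
    "L i (- v) = - L i v" "L i (u - v) = L i u - L i v"
    by (rule l.add l.scale l.zero l.neg l.diff)+
qed

lemma H_linear:
  "H i (u + v) = H i u + H i v" "H i (scale a v) = scale a (H i v)" "H i 0 = 0"
  "H i (- v) = - H i v" "H i (u - v) = H i u - H i v"
proof -
  interpret l: Vector_Spaces.linear scale scale "H i" by (rule linear_H)
  show "H i (u + v) = H i u + H i v" "H i (scale a v) = scale a (H i v)" "H i 0 = 0"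
    "H i (- v) = - H i v" "H i (u - v) = H i u - H i v"
    by (rule l.add l.scale l.zero l.neg l.diff)+
qed

definition E :: "int \<Rightarrow> 'v set" where
  "E n = {v. L 0 v = scale (\<alpha> + of_int n) v}"

definition support :: "int set" where
  "support = {n. \<exists>v\<in>E n. v \<noteq> 0}"

lemma L_0: "v \<in> E n \<Longrightarrow> L 0 v = scale (\<alpha> + of_int n) v"
  by (simp add: E_def)

lemma L_in_E: "v \<in> E n \<Longrightarrow> L i v \<in> E (n + i)"
  using LL[of 0 i v] by (simp add: E_def L_linear scale_left_distrib add_ac)

lemma H_in_E: "v \<in> E n \<Longrightarrow> H i v \<in> E (n + i)"
  using LH[of 0 i v] by (simp add: E_def H_linear scale_left_distrib add_ac)

lemma E_proportional: "u \<in> E n \<Longrightarrow> v \<in> E n \<Longrightarrow> u \<noteq> 0 \<Longrightarrow> \<exists>a. v = scale a u"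
  using multiplicity_one by (simp add: E_def)

lemma scale_in_E: "v \<in> E n \<Longrightarrow> scale a v \<in> E n"
  by (simp add: E_def L_linear scale_left_commute)

lemma E_eq_0: "n \<notin> support \<Longrightarrow> v \<in> E n \<Longrightarrow> v = 0"
  by (auto simp: support_def)

text \<open>The reflection \<open>i \<mapsto> -i\<close> turns the cocycle \<open>i\<^sup>2 + i\<close> into \<open>i\<^sup>2 - i\<close>; shifting \<open>I(0)\<close> by a multiple of
  \<open>C\<^sub>D\<^sub>I\<close> repairs this.\<close>

lemma weyl_flip:
  "hv_weight_rep scale (\<lambda>i v. - L (- i) v) (\<lambda>i v. H (- i) v + scale (if i = 0 then - 2 * d else 0) v)
     (- c) (- d) (- e) (F - 2 * d) (- \<alpha>)"
proof (intro hv_weight_rep.intro vector_space_axioms hv_weight_rep_axioms.intro)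
  fix i j :: int and u v :: 'v
  let ?H = "\<lambda>i v. H (- i) v + scale (if i = 0 then - 2 * d else 0) v"
  show "Vector_Spaces.linear scale scale (\<lambda>v. - L (- i) v)"
    by (simp add: Vector_Spaces.linear_iff vector_space_axioms L_linear)
  show "Vector_Spaces.linear scale scale (?H i)"
    by (simp add: Vector_Spaces.linear_iff vector_space_axioms H_linear scale_right_distrib scale_left_commute)
  show "- L (- i) (- L (- j) v) = - L (- j) (- L (- i) v) + scale (of_int (j - i)) (- L (- (i + j)) v)
      + scale (if i = - j then (of_int i ^ 3 - of_int i) / 12 * - c else 0) v"
  proof -
    define r where "r = (if i = - j then (of_int i ^ 3 - of_int i) / 12 * - c else 0)"
    have r: "r = (if - i = - (- j) then (of_int (- i) ^ 3 - of_int (- i)) / 12 * c else 0)"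
      by (auto simp: r_def field_simps)
    have "L (- i) (L (- j) v) = L (- j) (L (- i) v) - scale (of_int (j - i)) (L (- (i + j)) v) + scale r v"
      using LL[of "- i" "- j" v] unfolding r[symmetric] by (simp add: scale_left_diff_distrib)
    then show ?thesis by (simp only: r_def[symmetric] L_linear scale_minus_right minus_minus) simp
  qed
  show "- L (- i) (?H j v) = ?H j (- L (- i) v) + scale (of_int j) (?H (i + j) v)
      + scale (if i = - j then (of_int i ^ 2 + of_int i) * - d else 0) v"
  proof -
    define r where "r = (if i = - j then (of_int i ^ 2 + of_int i) * - d else 0)"
    define r' where "r' = (if - i = - (- j) then (of_int (- i) ^ 2 + of_int (- i)) * d else 0)"
    define h where "h k = (if k = 0 then - 2 * d else 0)" for k :: int
    have r: "of_int j * h (i + j) = - r' - r"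
    proof (cases "i = - j")
      case True
      show ?thesis unfolding True r_def r'_def h_def by (simp add: power2_eq_square algebra_simps)
    next
      case False
      then have "i + j \<noteq> 0" by linarith
      with False show ?thesis unfolding r_def r'_def h_def by simp
    qed
    have "L (- i) (H (- j) v) = H (- j) (L (- i) v) - scale (of_int j) (H (- (i + j)) v) + scale r' v"
      using LH[of "- i" "- j" v] unfolding r'_def[symmetric] by simp
    then show ?thesis
      unfolding r_def[symmetric] h_def[symmetric]
      by (simp add: L_linear H_linear scale_right_distrib r scale_left_diff_distrib)
  qed
  show "?H i (?H j v) = ?H j (?H i v) + scale (if i = - j then of_int i * - e else 0) v"
  proof -
    define r where "r = (if i = - j then of_int i * - e else 0)"
    define h where "h k = (if k = 0 then - 2 * d else 0)" for k :: int
    have r: "r = (if - i = - (- j) then of_int (- i) * e else 0)"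
      by (auto simp: r_def)
    have "H (- i) (H (- j) v) = H (- j) (H (- i) v) + scale r v"
      using HH[of "- i" "- j" v] unfolding r[symmetric] .
    then show ?thesis
      unfolding r_def[symmetric] h_def[symmetric]
      by (simp add: H_linear scale_right_distrib mult.commute)
  qed
  show "?H 0 v = scale (F - 2 * d) v" by (simp add: H_0 scale_left_diff_distrib)
  fix n assume "- L (- 0) u = scale (- \<alpha> + of_int n) u" "- L (- 0) v = scale (- \<alpha> + of_int n) v" "u \<noteq> 0"
  then have "L 0 u = scale (\<alpha> + of_int (- n)) u" "L 0 v = scale (\<alpha> + of_int (- n)) v"
    by (simp_all add: minus_equation_iff[of "L 0 _"] scale_minus_left[symmetric] del: scale_minus_left)
  then show "\<exists>a. v = scale a u" using multiplicity_one \<open>u \<noteq> 0\<close> by blast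
next
  fix U assume U: "subspace U" "\<And>i v. v \<in> U \<Longrightarrow> - L (- i) v \<in> U"
    "\<And>i v. v \<in> U \<Longrightarrow> H (- i) v + scale (if i = 0 then - 2 * d else 0) v \<in> U"
  show "U = {0} \<or> U = UNIV"
  proof (rule irreducible)
    fix i v assume v: "v \<in> U"
    show "L i v \<in> U" using U(2)[OF v, of "- i"] subspace_neg[OF U(1)] by fastforce
    have "(H i v + scale (if - i = 0 then - 2 * d else 0) v) - scale (if - i = 0 then - 2 * d else 0) v \<in> U"
      using U(3)[OF v, of "- i"] by (intro subspace_diff subspace_scale U(1) v) auto
    then show "H i v \<in> U" by simp
  qed (rule U)
next
  have "{v. \<exists>n. - L (- 0) v = scale (- \<alpha> + of_int n) v} = {v. \<exists>n. L 0 v = scale (\<alpha> + of_int n) v}"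
  proof -
    have "- L 0 v = scale (- \<alpha> + of_int n) v \<longleftrightarrow> L 0 v = scale (\<alpha> + of_int (- n)) v" for n v
      by (simp add: minus_equation_iff[of "L 0 v"] scale_minus_left[symmetric] del: scale_minus_left) auto
    then have "(\<exists>n. - L 0 v = scale (- \<alpha> + of_int n) v) \<longleftrightarrow> (\<exists>n. L 0 v = scale (\<alpha> + of_int n) v)" for v
      by (metis minus_minus)
    then show ?thesis by simp
  qed
  with spanning show "span {v. \<exists>n. - L (- 0) v = scale (- \<alpha> + of_int n) v} = UNIV" by simp
  show "\<exists>i v. - L (- i) v \<noteq> 0 \<or> H (- i) v + scale (if i = 0 then - 2 * d else 0) v \<noteq> 0"
  proof (rule ccontr)
    assume a: "\<not> ?thesis"
    then have L0: "L i v = 0" for i v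
      by (metis minus_minus neg_equal_0_iff_equal)
    have "H i v = 0" if "i \<noteq> 0" for i v
    proof -
      have "H (- (- i)) v + scale (if - i = 0 then - 2 * d else 0) v = 0" using a by blast
      with that show ?thesis by simp
    qed
    \<comment> \<open>\<open>I(0)\<close> is the bracket of \<open>x_{-1}\<close> and
      \<open>I(1)\<close>: the cocycle i^2 + i vanishes at i = -1.\<close>
    moreover have "H 0 v = 0" for v using LH[of "- 1" 1 v] L0 H_linear by simp
    ultimately have "H i v = 0" for i v by (cases "i = 0") auto
    with L0 nontrivial show False by blast
  qed
qed

lemma E_flip: "hv_weight_rep.E scale (\<lambda>i v. - L (- i) v) (- \<alpha>) n = E (- n)"
proof -
  interpret R: hv_weight_rep scale "\<lambda>i v. - L (- i) v"
     "\<lambda>i v. H (- i) v + scale (if i = 0 then - 2 * d else 0) v" "- c" "- d" "- e" "F - 2 * d" "- \<alpha>"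
    by (rule weyl_flip)
  have "- L 0 v = scale (- \<alpha> + of_int n) v \<longleftrightarrow> L 0 v = scale (\<alpha> + of_int (- n)) v" for n v
    by (simp add: minus_equation_iff[of "L 0 v"] scale_minus_left[symmetric] del: scale_minus_left) auto
  then show ?thesis by (simp add: R.E_def E_def)
qed

lemma support_flip: "n \<in> hv_weight_rep.support scale (\<lambda>i v. - L (- i) v) (- \<alpha>) \<longleftrightarrow> - n \<in> support"
proof -
  interpret R: hv_weight_rep scale "\<lambda>i v. - L (- i) v"
     "\<lambda>i v. H (- i) v + scale (if i = 0 then - 2 * d else 0) v" "- c" "- d" "- e" "F - 2 * d" "- \<alpha>"
    by (rule weyl_flip)
  show ?thesis by (simp add: R.support_def support_def E_flip)
qed

text \<open>A vector killed by $x_1$ is a highest weight vector for $\langle x_{-1}, x_0, x_1\rangle$; the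
  Verma module it generates is free over $x_{-1}$ when its weight has negative real part.\<close>

lemma gap_above:
  assumes n: "n \<in> support" "n + 1 \<notin> support" and neg: "Re \<alpha> + of_int n < 0"
  shows "k \<le> n \<Longrightarrow> k \<in> support"
proof -
  obtain v where v: "v \<in> E n" "v \<noteq> 0" using n by (auto simp: support_def)
  define w where "w k = (L (- 1) ^^ k) v" for k
  have wE: "w k \<in> E (n - int k)" for k
  proof (induction k)
    case (Suc k)
    from L_in_E[OF this, of "- 1"] show ?case by (simp add: w_def algebra_simps)
  qed (simp add: w_def v)
  have L1: "L 1 (w (Suc k)) = scale (- of_nat (Suc k) * (2 * (\<alpha> + of_int n) - of_nat k)) (w k)" for k
  proof (induction k)
    case 0
    have "L 1 v = 0" using L_in_E[OF v(1), of 1] n(2) by (rule_tac E_eq_0)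
    then show ?case using LL[of 1 "- 1" v] v(1)
      by (simp add: w_def L_0 L_linear)
  next
    case (Suc k)
    have "L 1 (w (Suc (Suc k))) = L (- 1) (L 1 (w (Suc k))) + scale (- 2) (L 0 (w (Suc k)))"
      using LL[of 1 "- 1" "w (Suc k)"] by (simp add: w_def)
    also have "\<dots> = scale (- of_nat (Suc k) * (2 * (\<alpha> + of_int n) - of_nat k)) (w (Suc k))
        + scale (- 2 * (\<alpha> + of_int (n - int (Suc k)))) (w (Suc k))"
      unfolding Suc.IH L_0[OF wE] by (simp add: L_linear w_def)
    also have "\<dots> = scale (- of_nat (Suc (Suc k)) * (2 * (\<alpha> + of_int n) - of_nat (Suc k))) (w (Suc k))"
      unfolding scale_left_distrib[symmetric] by (rule arg_cong[of _ _ "\<lambda>a. scale a _"]) (simp add: algebra_simps)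
    finally show ?case .
  qed
  have nz: "w k \<noteq> 0" for k
  proof (induction k)
    case (Suc k)
    have "2 * (\<alpha> + of_int n) - of_nat k \<noteq> 0"
    proof
      assume "2 * (\<alpha> + of_int n) - of_nat k = 0"
      then have "Re (2 * (\<alpha> + of_int n) - of_nat k) = 0" by simp
      with neg show False by simp
    qed
    moreover have "- of_nat (Suc k) \<noteq> (0::complex)" by (simp del: of_nat_Suc)
    ultimately have "scale (- of_nat (Suc k) * (2 * (\<alpha> + of_int n) - of_nat k)) (w k) \<noteq> 0"
      using Suc by (simp del: of_nat_Suc)
    then show ?case using L1[of k] L_linear(3) by metis
  qed (simp add: w_def v)
  assume "k \<le> n"
  with wE[of "nat (n - k)"] nz[of "nat (n - k)"] show "k \<in> support"
    by (auto simp: support_def)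
qed

text \<open>Otherwise there are a gap a at or above -Re \<alpha> and a first support point n beyond
  it. The weight at n has positive real part, so \<open>gap_above\<close> for the reflected module
  fills everything above n.\<close>

lemma support_bounded_above_or_tail:
  "(\<exists>N. \<forall>n\<ge>N. n \<in> support) \<or> (\<exists>N. \<forall>n\<in>support. n \<le> N)"
proof (rule ccontr)
  assume neg: "\<not> ?thesis"
  interpret R: hv_weight_rep scale "\<lambda>i v. - L (- i) v"
     "\<lambda>i v. H (- i) v + scale (if i = 0 then - 2 * d else 0) v" "- c" "- d" "- e" "F - 2 * d" "- \<alpha>"
    by (rule weyl_flip)
  obtain a where a: "a \<ge> \<lceil>- Re \<alpha>\<rceil>" "a \<notin> support" using neg by blast
  obtain b where b: "b \<in> support" "b > a" using neg by (metis not_le)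
  let ?D = "{n\<in>support. a < n \<and> n \<le> b}"
  have fin: "finite ?D" by (rule finite_subset[of _ "{a..b}"]) auto
  define n where "n = Min ?D"
  have n: "n \<in> ?D" unfolding n_def using b by (intro Min_in fin) auto
  have "n - 1 \<notin> support"
  proof
    assume "n - 1 \<in> support"
    moreover from this a n have "n - 1 \<noteq> a" by auto
    ultimately have "n - 1 \<in> ?D" using n by auto
    with fin have "n \<le> n - 1" unfolding n_def by (rule Min_le)
    then show False by simp
  qed
  then have "- n + 1 \<notin> R.support" unfolding support_flip by simp
  moreover have "- n \<in> R.support" unfolding support_flip using n by simp
  moreover have "Re \<alpha> + of_int n > 0" using a(1) n by simp linarith
  then have "Re (- \<alpha>) + of_int (- n) < 0" by simp
  ultimately have "- k \<in> R.support" if "n \<le> k" for k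
    using that by (intro R.gap_above[of "- n" "- k"]) simp_all
  then have "\<forall>k\<ge>n. k \<in> support" unfolding support_flip by simp
  with neg show False by blast
qed

text \<open>In a bounded support, \<open>x_i\<close> and \<open>x_{-i}\<close> kill every weight
  vector for large i, and so does their bracket. Two consecutive values of i then force c = 0 and
  weight 0. A single weight remains, on which everything acts as 0, contrary to
  nontriviality.\<close>

lemma support_unbounded: "\<not> (support \<subseteq> {a..b})"
proof
  assume S: "support \<subseteq> {a..b}"
  have m0: "\<alpha> + of_int n = 0" if n: "n \<in> support" for n
  proof -
    obtain v where v: "v \<in> E n" "v \<noteq> 0" using n by (auto simp: support_def)
    have "- 2 * of_int i * (\<alpha> + of_int n) + (of_int i ^ 3 - of_int i) / 12 * c = 0" if i: "i > b - a" for i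
    proof -
      have "n + i \<notin> support" "n + - i \<notin> support"
        using subsetD[OF S n] subsetD[OF S, of "n + i"] subsetD[OF S, of "n + - i"] i by auto
      then have "L i v = 0" "L (- i) v = 0" using L_in_E[OF v(1)] E_eq_0 by blast+
      then have "scale (- 2 * of_int i * (\<alpha> + of_int n) + (of_int i ^ 3 - of_int i) / 12 * c) v = 0"
        using LL[of i "- i" v] v(1) by (simp add: L_0 L_linear scale_left_distrib algebra_simps)
      with v(2) show ?thesis by simp
    qed
    then have *: "24 * of_int i * (\<alpha> + of_int n) = of_int i * (of_int i ^ 2 - 1) * c" if "i > b - a" for i
      using that by (simp add: field_simps power2_eq_square power3_eq_cube eq_neg_iff_add_eq_0)
    have **: "24 * (\<alpha> + of_int n) = (of_int i ^ 2 - 1) * c" if "i > b - a" "i > 0" for i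
    proof -
      have "of_int i * (24 * (\<alpha> + of_int n)) = of_int i * ((of_int i ^ 2 - 1) * c)"
        using *[OF that(1)] by (simp add: algebra_simps)
      then show ?thesis using that(2) by simp
    qed
    define i where "i = max (b - a) 0 + 1"
    have i: "i > b - a" "i > 0" "i + 1 > b - a" "i + 1 > 0" by (simp_all add: i_def)
    have "(of_int (i + 1) ^ 2 - 1) * c = (of_int i ^ 2 - 1) * c"
      using **[of i] **[of "i + 1"] i by metis
    then have "of_int (2 * i + 1) * c = 0" by (simp add: power2_eq_square algebra_simps)
    then have "c = 0" unfolding mult_eq_0_iff of_int_eq_0_iff using i(2) by linarith
    with **[OF i(1,2)] show ?thesis by (metis mult_zero_right mult_eq_0_iff zero_neq_numeral)
  qed
  have single: "n = n'" if "n \<in> support" "n' \<in> support" for n n'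
    using m0[OF that(1)] m0[OF that(2)] by (metis add_left_cancel of_int_eq_iff)
  have L0: "L i v = 0" and H0: "H i v = 0" if v: "v \<in> E n" for i n v
  proof -
    have z: "L i v = 0" if "i \<noteq> 0" for i
      using L_in_E[OF v, of i] single[of n "n + i"] E_eq_0 that v L_linear(3) by (metis add_cancel_left_right)
    show L: "L i v = 0" for i
    proof (cases "i = 0")
      case True
      show ?thesis
      proof (cases "v = 0")
        case False
        then have "n \<in> support" using v by (auto simp: support_def)
        with m0 v True show ?thesis by (simp add: L_0)
      qed (simp add: L_linear)
    qed (rule z)
    have zH: "H i v = 0" if "i \<noteq> 0" for i
      using H_in_E[OF v, of i] single[of n "n + i"] E_eq_0 that v H_linear(3) by (metis add_cancel_left_right)
    have "H 0 v = 0" using LH[of "- 1" 1 v] by (simp add: L zH L_linear H_linear)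
    with zH show "H i v = 0" by (cases "i = 0") auto
  qed
  have "subspace {v. \<forall>i. L i v = 0 \<and> H i v = 0}"
    by (auto simp: subspace_def L_linear H_linear)
  moreover have "{v. \<exists>n. L 0 v = scale (\<alpha> + of_int n) v} \<subseteq> {v. \<forall>i. L i v = 0 \<and> H i v = 0}"
    using L0 H0 by (auto simp: E_def)
  ultimately have "UNIV \<subseteq> {v. \<forall>i. L i v = 0 \<and> H i v = 0}"
    unfolding spanning[symmetric] by (intro span_minimal)
  with nontrivial show False by auto
qed

text \<open>The dichotomy is applied to the module and to its reflection; a support bounded on both
  sides is excluded by \<open>support_unbounded\<close>.\<close>

lemma support_tail: "(\<exists>N. \<forall>n\<ge>N. n \<in> support) \<or> (\<exists>N. \<forall>n\<le>N. n \<in> support)"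
proof -
  interpret R: hv_weight_rep scale "\<lambda>i v. - L (- i) v"
     "\<lambda>i v. H (- i) v + scale (if i = 0 then - 2 * d else 0) v" "- c" "- d" "- e" "F - 2 * d" "- \<alpha>"
    by (rule weyl_flip)
  have "(\<exists>N. \<forall>n\<le>N. n \<in> support) \<or> (\<exists>N. \<forall>n\<in>support. N \<le> n)"
  proof -
    consider N where "\<forall>n\<ge>N. n \<in> R.support" | N where "\<forall>n\<in>R.support. n \<le> N"
      using R.support_bounded_above_or_tail by blast
    then show ?thesis
    proof cases
      case 1
      then have "\<forall>n\<le>- N. n \<in> support"
        by (metis support_flip minus_minus neg_le_iff_le)
      then show ?thesis by blast
    next
      case 2
      then have "\<forall>n\<in>support. - N \<le> n"
        by (metis support_flip minus_minus neg_le_iff_le)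
      then show ?thesis by blast
    qed
  qed
  with support_bounded_above_or_tail support_unbounded show ?thesis
    by (metis atLeastAtMost_iff subsetI)
qed

end


section \<open>Normal form on a half line\<close>

context hv_weight_rep begin

text \<open>Multiplicity one makes \<open>L (- 1)\<close> after \<open>L 1\<close> a scalar on each
  weight space, and the bracket of \<open>x_1\<close> and \<open>x_{-1}\<close>, which is
  \<open>-2 x_0\<close>, fixes its increments. The constant \<phi> is the eigenvalue of
  \<open>x_{-1} x_1 - x_0^2 - x_0\<close>, the Casimir element of sl2 up to normalisation.\<close>

lemma casimir:
  assumes tail: "\<forall>n\<ge>N. n \<in> support"
  obtains g \<phi> where "\<And>n u. n \<ge> N \<Longrightarrow> u \<in> E n \<Longrightarrow> L (- 1) (L 1 u) = scale (g n) u"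
    "\<And>n. n \<ge> N \<Longrightarrow> g n = (\<alpha> + of_int n) * (\<alpha> + of_int n + 1) + \<phi>"
proof -
  obtain b where b: "\<And>n. n \<ge> N \<Longrightarrow> b n \<in> E n \<and> b n \<noteq> 0"
    using tail unfolding support_def by (atomize_elim, intro choice) blast
  have "\<exists>a. L (- 1) (L 1 (b n)) = scale a (b n)" if "n \<ge> N" for n
    using L_in_E[OF L_in_E[of "b n" n 1], of "- 1"] b[OF that] by (intro E_proportional) auto
  then obtain g where g: "\<And>n. n \<ge> N \<Longrightarrow> L (- 1) (L 1 (b n)) = scale (g n) (b n)" by metis
  have g': "L (- 1) (L 1 u) = scale (g n) u" if n: "n \<ge> N" and u: "u \<in> E n" for n u
  proof -
    obtain a where "u = scale a (b n)" using E_proportional u b[OF n] by blast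
    then show ?thesis using g[OF n] by (simp add: L_linear scale_left_commute)
  qed
  have step: "g (n + 1) = g n + 2 * (\<alpha> + of_int (n + 1))" if n: "n \<ge> N" for n
  proof -
    have bn: "b n \<in> E n" "b n \<noteq> 0" "b (n + 1) \<in> E (n + 1)" "b (n + 1) \<noteq> 0"
      using b[of n] b[of "n + 1"] n by auto
    obtain p where p: "L 1 (b n) = scale p (b (n + 1))"
      using E_proportional[OF bn(3) L_in_E[OF bn(1), of 1] bn(4)] by blast
    have "L (- 1) (b (n + 1)) \<in> E n" using L_in_E[OF bn(3), of "- 1"] by simp
    then obtain r where r: "L (- 1) (b (n + 1)) = scale r (b n)"
      using E_proportional[OF bn(1) _ bn(2)] by blast
    have "scale (g n) (b n) = scale (p * r) (b n)"
      using g[OF n, symmetric] unfolding p L_linear r scale_scale .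
    then have gn: "g n = p * r" using bn(2) by simp
    \<comment> \<open>Both orders of composition between the lines spanned by \<open>b n\<close> and
      \<open>b (n + 1)\<close> give the same scalar p r.\<close>
    have "L 1 (L (- 1) (b (n + 1))) = scale (r * p) (b (n + 1))"
      by (simp add: p r L_linear)
    moreover have "L 1 (L (- 1) (b (n + 1))) = scale (g (n + 1)) (b (n + 1)) + scale (- 2) (L 0 (b (n + 1)))"
      using LL[of 1 "- 1" "b (n + 1)"] g[of "n + 1"] n by simp
    ultimately have "scale (r * p) (b (n + 1)) = scale (g (n + 1) + - 2 * (\<alpha> + of_int (n + 1))) (b (n + 1))"
      unfolding L_0[OF bn(3)] scale_scale scale_left_distrib[symmetric] by argo
    then have "r * p = g (n + 1) + - 2 * (\<alpha> + of_int (n + 1))" using bn(4) scale_cancel_right by blast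
    then show ?thesis using gn by (simp add: algebra_simps)
  qed
  define \<phi> where "\<phi> = g N - (\<alpha> + of_int N) * (\<alpha> + of_int N + 1)"
  have "g n = (\<alpha> + of_int n) * (\<alpha> + of_int n + 1) + \<phi>" if "n \<ge> N" for n
    using that
  proof (induction n rule: int_ge_induct)
    case base
    show ?case by (simp add: \<phi>_def)
  next
    case (step n)
    then show ?case using \<open>\<And>n. n \<ge> N \<Longrightarrow> g (n + 1) = _\<close>[of n] by (simp add: algebra_simps)
  qed
  with g' show thesis by (rule that)
qed

text \<open>The quadratic has finitely many roots. To their right \<open>L 1\<close> kills no
  nonzero weight vector, so its iterates on one vector provide a basis vector of every
  weight.\<close>

lemma casimir_chain:
  assumes tail: "\<forall>n\<ge>N. n \<in> support"
  obtains N' f \<phi> v where "\<And>k. v k \<in> E (N' + int k)" "\<And>k. v k \<noteq> 0"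
    "\<And>k. L 1 (v k) = v (Suc k)" "\<And>k. L (- 1) (v (Suc k)) = scale (f k) (v k)"
    "\<And>k. f k = (\<alpha> + of_int N' + of_nat k) * (\<alpha> + of_int N' + of_nat k + 1) + \<phi>" "\<And>k. f k \<noteq> 0"
proof -
  obtain g \<phi> where g: "\<And>n u. n \<ge> N \<Longrightarrow> u \<in> E n \<Longrightarrow> L (- 1) (L 1 u) = scale (g n) u"
    and g\<phi>: "\<And>n. n \<ge> N \<Longrightarrow> g n = (\<alpha> + of_int n) * (\<alpha> + of_int n + 1) + \<phi>"
    using casimir[OF tail] by blast
  have "finite {n. n \<ge> N \<and> g n = 0}"
  proof -
    have "finite {z. poly [:\<phi>, 1, 1:] z = 0}" by (rule poly_roots_finite) simp
    then have "finite ((\<lambda>n. \<alpha> + of_int n) -` {z. poly [:\<phi>, 1, 1:] z = 0})"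
      by (rule finite_vimageI) (auto intro: injI)
    then show ?thesis
      by (rule rev_finite_subset) (auto simp: g\<phi> algebra_simps)
  qed
  then obtain B where B: "\<And>n. n \<ge> N \<Longrightarrow> g n = 0 \<Longrightarrow> n \<le> B"
    using Max_ge by blast
  define N' where "N' = max N (B + 1)"
  have nz: "g n \<noteq> 0" if "n \<ge> N'" for n using B[of n] that by (auto simp: N'_def)
  obtain b where b: "b \<in> E N'" "b \<noteq> 0"
    using tail[rule_format, of N'] by (auto simp: N'_def support_def)
  define v where "v k = (L 1 ^^ k) b" for k
  have vE: "v k \<in> E (N' + int k)" for k
  proof (induction k)
    case (Suc k)
    from L_in_E[OF this, of 1] show ?case by (simp add: v_def algebra_simps)
  qed (simp add: v_def b)
  have down: "L (- 1) (v (Suc k)) = scale (g (N' + int k)) (v k)" for k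
    using g[OF _ vE[of k]] by (simp add: v_def N'_def)
  have g\<phi>': "g (N' + int k) = (\<alpha> + of_int N' + of_nat k) * (\<alpha> + of_int N' + of_nat k + 1) + \<phi>" for k
    using g\<phi>[of "N' + int k"] by (simp add: N'_def add.assoc)
  have "v k \<noteq> 0" for k
  proof (induction k)
    case (Suc k)
    then have "L (- 1) (v (Suc k)) \<noteq> 0" unfolding down using nz[of "N' + int k"] by simp
    then show ?case by (metis L_linear(3))
  qed (simp add: v_def b)
  with vE show thesis
  proof (rule that)
    show "L 1 (v k) = v (Suc k)" for k by (simp add: v_def)
    show "g (N' + int k) \<noteq> 0" for k by (rule nz) simp
  qed (rule down g\<phi>')+
qed

end

text \<open>The vector \<open>w n\<close> plays the role of the basis vector of weight \<alpha> + n,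
  and the formulas are required only while source and target stay in the half line. Excluding
  \<beta> = F = 0 ensures that no nonzero vector of V(\<alpha>,\<beta>;F) is killed by all
  \<open>x_i\<close> and \<open>I(i)\<close> with i large.\<close>

locale hv_tail = hv_weight_rep scale L H 0 0 0 F \<alpha>
  for scale :: "complex \<Rightarrow> 'v::ab_group_add \<Rightarrow> 'v" and L H F \<alpha> +
  fixes M :: int and \<beta> :: complex and w :: "int \<Rightarrow> 'v"
  assumes \<beta>F: "\<beta> \<noteq> 0 \<or> F \<noteq> 0"
    and w_nz: "n \<ge> M \<Longrightarrow> w n \<noteq> 0"
    and L_w: "n \<ge> M \<Longrightarrow> n + i \<ge> M \<Longrightarrow> L i (w n) = scale (\<alpha> + of_int n + \<beta> * of_int i) (w (n + i))"
    and H_w: "n \<ge> M \<Longrightarrow> n + i \<ge> M \<Longrightarrow> H i (w n) = scale F (w (n + i))"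

context hv_weight_rep begin

text \<open>The difference equations determine \<open>x_i\<close> for i = 1, -1, 2, -2 and
  \<open>I(i)\<close> for i = 1, -1 on the chain. Brackets with \<open>x_1\<close> and
  \<open>x_{-1}\<close> produce all remaining indices.\<close>

lemma tail_normal_form:
  assumes tail: "\<forall>n\<ge>N. n \<in> support"
  obtains M \<beta> w where "c = 0" "d = 0" "e = 0" "hv_tail scale L H F \<alpha> M \<beta> w"
proof -
  obtain M f \<phi> v where vE: "\<And>k. v k \<in> E (M + int k)" and v0: "\<And>k. v k \<noteq> 0"
    and L1: "\<And>k. L 1 (v k) = v (Suc k)" and L_1: "\<And>k. L (- 1) (v (Suc k)) = scale (f k) (v k)"
    and f: "\<And>k. f k = (\<alpha> + of_int M + of_nat k) * (\<alpha> + of_int M + of_nat k + 1) + \<phi>"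
    and f_nz: "\<And>k. f k \<noteq> 0"
  proof (rule casimir_chain[OF tail], goal_cases)
    case (1 v' M' f' \<phi>')
    note facts = 1
    show ?case by (rule 1(1); rule facts)
  qed

  \<comment> \<open>Coefficients of the operators of small index and their recurrences\<close>
  have "\<exists>a. L 2 (v k) = scale a (v (Suc (Suc k)))" for k
    using L_in_E[OF vE[of k], of 2] vE[of "Suc (Suc k)"] v0 by (intro E_proportional) (simp_all add: add_ac)
  then obtain s where L2: "\<And>k. L 2 (v k) = scale (s k) (v (Suc (Suc k)))" by metis
  have "\<exists>a. L (- 2) (v (Suc (Suc k))) = scale a (v k)" for k
    using L_in_E[OF vE[of "Suc (Suc k)"], of "- 2"] vE[of k] v0 by (intro E_proportional) (simp_all add: add_ac)
  then obtain t where L_2: "\<And>k. L (- 2) (v (Suc (Suc k))) = scale (t k) (v k)" by metis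
  have "\<exists>a. H 1 (v k) = scale a (v (Suc k))" for k
    using H_in_E[OF vE[of k], of 1] vE[of "Suc k"] v0 by (intro E_proportional) (simp_all add: add_ac)
  then obtain q where H1: "\<And>k. H 1 (v k) = scale (q k) (v (Suc k))" by metis
  have "\<exists>a. H (- 1) (v (Suc k)) = scale a (v k)" for k
    using H_in_E[OF vE[of "Suc k"], of "- 1"] vE[of k] v0 by (intro E_proportional) (simp_all add: add_ac)
  then obtain u where H_1: "\<And>k. H (- 1) (v (Suc k)) = scale (u k) (v k)" by metis
  have scale_eqD: "a = b" if "scale a (v k) = scale b (v k)" for a b k
    using that v0[of k] scale_cancel_right by blast
  define \<mu> where "\<mu> = \<alpha> + of_int M"
  have L0: "L 0 (v k) = scale (\<mu> + of_nat k) (v k)" for k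
    using L_0[OF vE[of k]] by (simp add: \<mu>_def add.assoc)
  note ops = v0 L1 L_1 L2 L_2 H1 H_1 L0 H_0 L_linear H_linear scale_left_distrib scale_right_distrib
    scale_left_diff_distrib
  interpret G: germ_coefficients f s t q u \<mu> \<phi> F c d e
  proof
    fix k
    show "f k = (\<mu> + of_nat k) * (\<mu> + of_nat k + 1) + \<phi>" by (simp add: f \<mu>_def)
    show "f k \<noteq> 0" by (rule f_nz)
    have "scale (s (Suc k) * f (Suc (Suc k))) (v (Suc (Suc k))) = scale (s k * f k + 3) (v (Suc (Suc k)))"
      using LL[of "- 1" 2 "v (Suc k)"] by (simp add: ops mult.commute)
    from scale_eqD[OF this] show "s (Suc k) * f (Suc (Suc k)) - s k * f k = 3" by simp
    have "scale (t k) (v (Suc k)) = scale (t (Suc k) - 3 * f (Suc k)) (v (Suc k))"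
      using LL[of 1 "- 2" "v (Suc (Suc k))"] by (simp add: ops)
    from scale_eqD[OF this] show "t k - t (Suc k) = - 3 * f (Suc k)" by simp
    have "scale (t k * s k) (v (Suc (Suc k))) = scale (s (Suc (Suc k)) * t (Suc (Suc k)) +
        (- 4 * (\<mu> + of_nat k + 2) + c / 2)) (v (Suc (Suc k)))"
      using LL[of 2 "- 2" "v (Suc (Suc k))"] by (simp add: ops add_ac)
    from scale_eqD[OF this] show "t k * s k - s (Suc (Suc k)) * t (Suc (Suc k)) = - 4 * (\<mu> + of_nat k + 2) + c / 2"
      by simp
    have "scale (q (Suc k) * f (Suc k)) (v (Suc k)) = scale (q k * f k + F) (v (Suc k))"
      using LH[of "- 1" 1 "v (Suc k)"] by (simp add: ops mult.commute)
    from scale_eqD[OF this] show "q (Suc k) * f (Suc k) - q k * f k = F" by simp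
    have "scale (u k) (v (Suc k)) = scale (u (Suc k) - F + 2 * d) (v (Suc k))"
      using LH[of 1 "- 1" "v (Suc k)"] by (simp add: ops)
    from scale_eqD[OF this] show "u k - u (Suc k) = - F + 2 * d" by simp
    have "scale (q (Suc (Suc k)) * t (Suc k)) (v (Suc k)) = scale (t k * q k + u (Suc k)) (v (Suc k))"
      using LH[of "- 2" 1 "v (Suc (Suc k))"] by (simp add: ops mult.commute)
    from scale_eqD[OF this] show "q (Suc (Suc k)) * t (Suc k) - t k * q k = u (Suc k)" by simp
    have "scale (u k * q k) (v (Suc k)) = scale (q (Suc k) * u (Suc k) + e) (v (Suc k))"
      using HH[of 1 "- 1" "v (Suc k)"] by (simp add: ops mult.commute)
    from scale_eqD[OF this] show "u k * q k - q (Suc k) * u (Suc k) = e" by simp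
  qed
  obtain \<beta> where 0: "c = 0" "d = 0" "e = 0" "\<beta> \<noteq> 0 \<or> F \<noteq> 0"
    and nz: "\<And>k. \<mu> + of_nat k + \<beta> \<noteq> 0"
    and f\<beta>: "\<And>k. f k = (\<mu> + of_nat k + \<beta>) * (\<mu> + of_nat k + 1 - \<beta>)"
    and s\<beta>: "\<And>k. s k * ((\<mu> + of_nat k + \<beta>) * (\<mu> + of_nat k + 1 + \<beta>)) = \<mu> + of_nat k + 2 * \<beta>"
    and t\<beta>: "\<And>k. t k = (\<mu> + of_nat k + 2 - 2 * \<beta>) * ((\<mu> + of_nat k + \<beta>) * (\<mu> + of_nat k + 1 + \<beta>))"
    and q\<beta>: "\<And>k. q k * (\<mu> + of_nat k + \<beta>) = F"
    and u\<beta>: "\<And>k. u k = F * (\<mu> + of_nat k + \<beta>)"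
    by (rule G.normal_form) (rule that; blast)

  \<comment> \<open>Rescaling the chain to the basis of V(\<alpha>,\<beta>;F)\<close>
  define \<rho> where "\<rho> k = (\<Prod>j<k. \<mu> + of_nat j + \<beta>)" for k
  have \<rho>0: "\<rho> k \<noteq> 0" for k using nz by (simp add: \<rho>_def)
  have \<rho>S: "\<rho> (Suc k) = \<rho> k * (\<mu> + of_nat k + \<beta>)" for k by (simp add: \<rho>_def)
  \<comment> \<open>In V(\<alpha>,\<beta>;F) each application of \<open>x_1\<close> contributes a
    factor \<mu> + j + \<beta>, so the k-th chain vector should be \<rho> k times the k-th basis
    vector.\<close>
  define w where "w n = scale (inverse (\<rho> (nat (n - M)))) (v (nat (n - M)))" for n
  have w0: "w n \<noteq> 0" for n using \<rho>0 v0 by (simp add: w_def)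
  have wv: "v k = scale (\<rho> k) (w (M + int k))" for k using \<rho>0[of k] by (simp add: w_def)
  have cancel: "x = y" if "scale (\<rho> k) x = scale (\<rho> k) y" for x y k
    using that \<rho>0[of k] scale_cancel_left by blast
  have ex: "\<exists>k. n = M + int k" if "n \<ge> M" for n using that zle_iff_zadd by blast
  have w1: "L 1 (w n) = scale (\<alpha> + of_int n + \<beta>) (w (n + 1))" if n: "n \<ge> M" for n
  proof -
    obtain k where k: "n = M + int k" using ex[OF n] by blast
    have "scale (\<rho> k) (L 1 (w n)) = scale (\<rho> k) (scale (\<mu> + of_nat k + \<beta>) (w (n + 1)))"
      using L1[of k] by (simp add: wv L_linear k \<rho>S add_ac)
    from cancel[OF this] show ?thesis by (simp add: k \<mu>_def add_ac)
  qed
  have w_1: "L (- 1) (w n) = scale (\<alpha> + of_int n - \<beta>) (w (n - 1))" if n: "n \<ge> M + 1" for n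
  proof -
    obtain k where "n - 1 = M + int k" using ex[of "n - 1"] n by auto
    then have k: "n = M + int (Suc k)" by simp
    have "scale (\<rho> (Suc k)) (L (- 1) (w n)) = scale (\<rho> (Suc k)) (scale (\<mu> + of_nat k + 1 - \<beta>) (w (n - 1)))"
      using L_1[of k] by (simp add: wv L_linear k \<rho>S f\<beta> ac_simps)
    from cancel[OF this] show ?thesis by (simp add: k \<mu>_def add_ac)
  qed
  have w2: "L 2 (w n) = scale (\<alpha> + of_int n + 2 * \<beta>) (w (n + 2))" if n: "n \<ge> M" for n
  proof -
    obtain k where k: "n = M + int k" using ex[OF n] by blast
    have "scale (\<rho> k) (L 2 (w n)) = scale (\<rho> k * (s k * ((\<mu> + of_nat k + \<beta>) * (\<mu> + of_nat k + 1 + \<beta>)))) (w (n + 2))"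
      using L2[of k] by (simp add: wv L_linear k \<rho>S ac_simps)
    then have "scale (\<rho> k) (L 2 (w n)) = scale (\<rho> k) (scale (\<mu> + of_nat k + 2 * \<beta>) (w (n + 2)))"
      unfolding s\<beta> by simp
    from cancel[OF this] show ?thesis by (simp add: k \<mu>_def add_ac)
  qed
  have w_2: "L (- 2) (w n) = scale (\<alpha> + of_int n - 2 * \<beta>) (w (n - 2))" if n: "n \<ge> M + 2" for n
  proof -
    obtain k where "n - 2 = M + int k" using ex[of "n - 2"] n by auto
    then have k: "n = M + int (Suc (Suc k))" by simp
    have "scale (\<rho> (Suc (Suc k))) (L (- 2) (w n)) = scale (\<rho> (Suc (Suc k))) (scale (\<mu> + of_nat k + 2 - 2 * \<beta>) (w (n - 2)))"
      using L_2[of k] by (simp add: wv L_linear k \<rho>S t\<beta> ac_simps)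
    from cancel[OF this] show ?thesis by (simp add: k \<mu>_def add_ac)
  qed
  have h1: "H 1 (w n) = scale F (w (n + 1))" if n: "n \<ge> M" for n
  proof -
    obtain k where k: "n = M + int k" using ex[OF n] by blast
    have "scale (\<rho> k) (H 1 (w n)) = scale (\<rho> k * (q k * (\<mu> + of_nat k + \<beta>))) (w (n + 1))"
      using H1[of k] by (simp add: wv H_linear k \<rho>S ac_simps)
    then have "scale (\<rho> k) (H 1 (w n)) = scale (\<rho> k) (scale F (w (n + 1)))"
      unfolding q\<beta> by simp
    from cancel[OF this] show ?thesis .
  qed
  have h_1: "H (- 1) (w n) = scale F (w (n - 1))" if n: "n \<ge> M + 1" for n
  proof -
    obtain k where "n - 1 = M + int k" using ex[of "n - 1"] n by auto
    then have k: "n = M + int (Suc k)" by simp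
    have "scale (\<rho> (Suc k)) (H (- 1) (w n)) = scale (\<rho> (Suc k)) (scale F (w (n - 1)))"
      using H_1[of k] by (simp add: wv H_linear k \<rho>S u\<beta> ac_simps)
    from cancel[OF this] show ?thesis .
  qed
  have w00: "L 0 (w n) = scale (\<alpha> + of_int n) (w n)" if n: "n \<ge> M" for n
  proof -
    obtain k where k: "n = M + int k" using ex[OF n] by blast
    show ?thesis using scale_in_E[OF vE[of k]] by (intro L_0) (simp add: w_def k)
  qed

  \<comment> \<open>Operators of arbitrary index, by induction\<close>
  have pos: "L (int (Suc i)) (w n) = scale (\<alpha> + of_int n + \<beta> * of_nat (Suc i)) (w (n + int (Suc i)))"
    if "n \<ge> M" for i n
    using that
  proof (induction i arbitrary: n rule: less_induct)
    case (less i)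
    \<comment> \<open>The bracket of \<open>x_1\<close> and \<open>x_i\<close> is (i - 1) times
      \<open>x_{i+1}\<close> and gives nothing at i = 1. Hence \<open>x_1\<close> and
      \<open>x_2\<close> are both base cases.\<close>
    consider "i = 0" | "i = 1" | j where "i = Suc (Suc j)" by (metis One_nat_def not0_implies_Suc)
    then show ?case
    proof cases
      case 3
      let ?i = "int (Suc (Suc j))" and ?z = "\<alpha> + of_int n"
      have ih: "L ?i (w n) = scale (\<alpha> + of_int n + \<beta> * of_int ?i) (w (n + ?i))" if "n \<ge> M" for n
        using less.IH[of "Suc j" n] 3 that by simp
      have i0: "of_int (?i - 1) \<noteq> (0::complex)" unfolding of_int_eq_0_iff by simp
      have "scale (of_int (?i - 1)) (L (?i + 1) (w n)) = L 1 (L ?i (w n)) - L ?i (L 1 (w n))"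
        using LL[of 1 ?i "w n"] by (simp add: add_ac)
      also have "\<dots> = scale ((?z + \<beta> * of_int ?i) * (?z + of_int ?i + \<beta>) - (?z + \<beta>) * (?z + 1 + \<beta> * of_int ?i))
          (w (n + ?i + 1))"
        using less.prems ih w1 by (simp add: L_linear scale_left_diff_distrib add_ac)
      also have "\<dots> = scale (of_int (?i - 1)) (scale (?z + \<beta> * of_int (?i + 1)) (w (n + ?i + 1)))"
        unfolding scale_scale by (rule arg_cong[of _ _ "\<lambda>a. scale a _"]) (simp add: algebra_simps)
      finally have "L (?i + 1) (w n) = scale (?z + \<beta> * of_int (?i + 1)) (w (n + ?i + 1))"
        using i0 unfolding scale_cancel_left by blast
      with 3 show ?thesis by (simp add: add_ac)
    qed (use less.prems w1 w2 in \<open>simp_all add: mult.commute\<close>)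
  qed
  have neg: "L (- int (Suc i)) (w n) = scale (\<alpha> + of_int n - \<beta> * of_nat (Suc i)) (w (n - int (Suc i)))"
    if "n - int (Suc i) \<ge> M" for i n
    using that
  proof (induction i arbitrary: n rule: less_induct)
    case (less i)
    consider "i = 0" | "i = 1" | j where "i = Suc (Suc j)" by (metis One_nat_def not0_implies_Suc)
    then show ?case
    proof cases
      case 3
      let ?i = "int (Suc (Suc j))" and ?z = "\<alpha> + of_int n"
      have ih: "L (- ?i) (w n) = scale (\<alpha> + of_int n - \<beta> * of_int ?i) (w (n - ?i))" if "n - ?i \<ge> M" for n
        using less.IH[of "Suc j" n] 3 that by simp
      have i0: "of_int (1 - ?i) \<noteq> (0::complex)" unfolding of_int_eq_0_iff by simp
      have "scale (of_int (1 - ?i)) (L (- (?i + 1)) (w n)) = L (- 1) (L (- ?i) (w n)) - L (- ?i) (L (- 1) (w n))"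
        using LL[of "- 1" "- ?i" "w n"] by (simp add: add_ac)
      also have "\<dots> = scale ((?z - \<beta> * of_int ?i) * (?z - of_int ?i - \<beta>) - (?z - \<beta>) * (?z - 1 - \<beta> * of_int ?i))
          (w (n - ?i - 1))"
      proof -
        have eq: "n - 1 - ?i = n - ?i - 1" by simp
        have le: "n - ?i \<ge> M" "n - ?i \<ge> M + 1" "n - 1 - ?i \<ge> M" "n \<ge> M + 1"
          using less.prems 3 by auto
        have "L (- 1) (L (- ?i) (w n)) = scale ((?z - \<beta> * of_int ?i) * (?z - of_int ?i - \<beta>)) (w (n - ?i - 1))"
          unfolding ih[OF le(1)] L_linear w_1[OF le(2)] scale_scale
          by (rule arg_cong[of _ _ "\<lambda>a. scale a _"]) (simp add: algebra_simps)
        moreover have "L (- ?i) (L (- 1) (w n)) = scale ((?z - \<beta>) * (?z - 1 - \<beta> * of_int ?i)) (w (n - ?i - 1))"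
          unfolding w_1[OF le(4)] L_linear ih[OF le(3)] scale_scale eq
          by (rule arg_cong[of _ _ "\<lambda>a. scale a _"]) (simp add: algebra_simps)
        ultimately show ?thesis by (simp only: scale_left_diff_distrib)
      qed
      also have "\<dots> = scale (of_int (1 - ?i)) (scale (?z - \<beta> * of_int (?i + 1)) (w (n - ?i - 1)))"
        unfolding scale_scale by (rule arg_cong[of _ _ "\<lambda>a. scale a _"]) (simp add: algebra_simps)
      finally have "L (- (?i + 1)) (w n) = scale (?z - \<beta> * of_int (?i + 1)) (w (n - ?i - 1))"
        using i0 unfolding scale_cancel_left by blast
      with 3 show ?thesis by (simp add: algebra_simps)
    qed (use less.prems w_1 w_2 in \<open>simp_all add: mult.commute\<close>)
  qed
  have hpos: "H (int (Suc i)) (w n) = scale F (w (n + int (Suc i)))" if "n \<ge> M" for i n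
    using that
  proof (induction i arbitrary: n)
    case (Suc i)
    let ?i = "int (Suc i)"
    \<comment> \<open>The bracket of \<open>x_1\<close> and \<open>I(i)\<close> is i times
      \<open>I(i+1)\<close>, with i at least 1, so a single base case is enough.\<close>
    have i0: "of_int ?i \<noteq> (0::complex)" unfolding of_int_eq_0_iff by simp
    have "scale (of_int ?i) (H (?i + 1) (w n)) = L 1 (H ?i (w n)) - H ?i (L 1 (w n))"
      using LH[of 1 ?i "w n"] by (simp add: add_ac)
    also have "\<dots> = scale (of_int ?i) (scale F (w (n + ?i + 1)))"
    proof -
      have eq: "n + 1 + ?i = n + ?i + 1" by simp
      have le: "n \<ge> M" "n + ?i \<ge> M" "n + 1 \<ge> M"
        using Suc.prems by auto
      have "L 1 (H ?i (w n)) = scale (F * (\<alpha> + of_int (n + ?i) + \<beta>)) (w (n + ?i + 1))"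
        unfolding Suc.IH[OF le(1)] L_linear w1[OF le(2)] scale_scale ..
      moreover have "H ?i (L 1 (w n)) = scale ((\<alpha> + of_int n + \<beta>) * F) (w (n + ?i + 1))"
        unfolding w1[OF le(1)] H_linear Suc.IH[OF le(3)] scale_scale eq ..
      ultimately have "L 1 (H ?i (w n)) - H ?i (L 1 (w n)) =
          scale (F * (\<alpha> + of_int (n + ?i) + \<beta>) - (\<alpha> + of_int n + \<beta>) * F) (w (n + ?i + 1))"
        by (simp only: scale_left_diff_distrib)
      also have "\<dots> = scale (of_int ?i) (scale F (w (n + ?i + 1)))"
        unfolding scale_scale by (rule arg_cong[of _ _ "\<lambda>a. scale a _"]) (simp add: algebra_simps)
      finally show ?thesis .
    qed
    finally have "H (?i + 1) (w n) = scale F (w (n + ?i + 1))"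
      using i0 unfolding scale_cancel_left by blast
    then show ?case by (simp add: add_ac)
  qed (use h1 in simp)
  have hneg: "H (- int (Suc i)) (w n) = scale F (w (n - int (Suc i)))" if "n - int (Suc i) \<ge> M" for i n
    using that
  proof (induction i arbitrary: n)
    case (Suc i)
    let ?i = "int (Suc i)"
    have i0: "of_int (- ?i) \<noteq> (0::complex)" unfolding of_int_eq_0_iff by simp
    have "scale (of_int (- ?i)) (H (- (?i + 1)) (w n)) = L (- 1) (H (- ?i) (w n)) - H (- ?i) (L (- 1) (w n))"
      using LH[of "- 1" "- ?i" "w n"] by (simp add: add_ac)
    also have "\<dots> = scale (of_int (- ?i)) (scale F (w (n - ?i - 1)))"
    proof -
      have eq: "n - 1 - ?i = n - ?i - 1" by simp
      have le: "n - ?i \<ge> M" "n - ?i \<ge> M + 1" "n - 1 - ?i \<ge> M" "n \<ge> M + 1"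
        using Suc.prems by auto
      have "L (- 1) (H (- ?i) (w n)) = scale (F * (\<alpha> + of_int (n - ?i) - \<beta>)) (w (n - ?i - 1))"
        unfolding Suc.IH[OF le(1)] L_linear w_1[OF le(2)] scale_scale ..
      moreover have "H (- ?i) (L (- 1) (w n)) = scale ((\<alpha> + of_int n - \<beta>) * F) (w (n - ?i - 1))"
        unfolding w_1[OF le(4)] H_linear Suc.IH[OF le(3)] scale_scale eq ..
      ultimately have "L (- 1) (H (- ?i) (w n)) - H (- ?i) (L (- 1) (w n)) =
          scale (F * (\<alpha> + of_int (n - ?i) - \<beta>) - (\<alpha> + of_int n - \<beta>) * F) (w (n - ?i - 1))"
        by (simp only: scale_left_diff_distrib)
      also have "\<dots> = scale (of_int (- ?i)) (scale F (w (n - ?i - 1)))"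
        unfolding scale_scale by (rule arg_cong[of _ _ "\<lambda>a. scale a _"]) (simp add: algebra_simps)
      finally show ?thesis .
    qed
    finally have "H (- (?i + 1)) (w n) = scale F (w (n - ?i - 1))"
      using i0 unfolding scale_cancel_left by blast
    then show ?case by (simp add: algebra_simps)
  qed (use h_1 in simp)
  show thesis
  proof (rule that[OF 0(1-3)], intro hv_tail.intro hv_tail_axioms.intro)
    show "hv_weight_rep scale L H 0 0 0 F \<alpha>" using hv_weight_rep_axioms by (simp only: 0(1-3))
    show "\<beta> \<noteq> 0 \<or> F \<noteq> 0" by (rule 0(4))
    fix n i :: int assume n: "n \<ge> M" "n + i \<ge> M"
    consider "i = 0" | j where "i = int (Suc j)" | j where "i = - int (Suc j)"
      by (metis int_cases of_nat_0 old.nat.exhaust)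
    then have "L i (w n) = scale (\<alpha> + of_int n + \<beta> * of_int i) (w (n + i)) \<and> H i (w n) = scale F (w (n + i))"
    proof cases
      case 1
      then show ?thesis using w00[OF n(1)] by (simp add: H_0)
    next
      case (2 j)
      show ?thesis unfolding 2 pos[OF n(1)] hpos[OF n(1)] by simp
    next
      case (3 j)
      then have le: "n - int (Suc j) \<ge> M" using n(2) by simp
      have eq: "n + - int (Suc j) = n - int (Suc j)"
        "\<alpha> + of_int n - \<beta> * of_nat (Suc j) = \<alpha> + of_int n + \<beta> * of_int (- int (Suc j))"
        by (simp_all add: algebra_simps)
      show ?thesis unfolding 3 neg[OF le] hneg[OF le] eq by simp
    qed
    then show "L i (w n) = scale (\<alpha> + of_int n + \<beta> * of_int i) (w (n + i))"
      "H i (w n) = scale F (w (n + i))" by blast+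
  qed (rule w0)
qed

end


section \<open>The embedding into an intermediate series module\<close>

lemma lookup_intermediate_act:
  "Poly_Mapping.lookup (intermediate_act \<alpha> \<beta> F (hv_basis (X i)) p) k =
     (\<alpha> + of_int (k - i) + \<beta> * of_int i) * Poly_Mapping.lookup p (k - i)"
  "Poly_Mapping.lookup (intermediate_act \<alpha> \<beta> F (hv_basis (I i)) p) k = F * Poly_Mapping.lookup p (k - i)"
proof (induction p rule: poly_mapping_basis_induct)
  case (single a z)
  { case 1 then show ?case by (auto simp: intermediate_act_simps lookup_single when_def) next
    case 2 then show ?case by (auto simp: intermediate_act_simps lookup_single when_def) }
qed (simp_all add: intermediate_act_simps lookup_add algebra_simps)

lemma intermediate_act_linear:
  "intermediate_act \<alpha> \<beta> F x (p + q) = intermediate_act \<alpha> \<beta> F x p + intermediate_act \<alpha> \<beta> F x q"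
  "intermediate_act \<alpha> \<beta> F x (fscale z p) = fscale z (intermediate_act \<alpha> \<beta> F x p)"
  by (simp_all add: intermediate_act_def bilinear_ext_add bilinear_ext_scale_right)

text \<open>The support of p is finite and \<open>x_i\<close>, \<open>I(i)\<close> shift it by i, so
  large i move it past any bound.\<close>

lemma eventually_keys_ge:
  fixes p :: "int \<Rightarrow>\<^sub>0 complex"
  obtains B where "\<And>i. i \<ge> B \<Longrightarrow> Poly_Mapping.keys (intermediate_act \<alpha> \<beta> F (hv_basis (X i)) p) \<subseteq> {K..}"
    "\<And>i. i \<ge> B \<Longrightarrow> Poly_Mapping.keys (intermediate_act \<alpha> \<beta> F (hv_basis (I i)) p) \<subseteq> {K..}"
proof -
  define m where "m = Min (insert 0 (Poly_Mapping.keys p))"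
  have m: "Poly_Mapping.lookup p k = 0" if "k < m" for k
  proof (rule ccontr)
    assume "Poly_Mapping.lookup p k \<noteq> 0"
    then have "k \<in> insert 0 (Poly_Mapping.keys p)" by (simp add: in_keys_iff)
    then have "m \<le> k" unfolding m_def by (intro Min_le) simp_all
    with that show False by simp
  qed
  have "k \<ge> K" if "i \<ge> K - m" "Poly_Mapping.lookup p (k - i) \<noteq> 0" for i k
    using that m[of "k - i"] by linarith
  then show thesis
    by (intro that[of "K - m"]) (auto simp: in_keys_iff lookup_intermediate_act)
qed

context hv_tail
begin

abbreviation WL where "WL i \<equiv> intermediate_act \<alpha> \<beta> F (hv_basis (X i))"
abbreviation WH where "WH i \<equiv> intermediate_act \<alpha> \<beta> F (hv_basis (I i))"

section \<open>The half line of V(\<alpha>,\<beta>;F) and its copy in V\<close>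

lemma W_relations:
  "WL i (WL j p) = WL j (WL i p) + fscale (of_int (j - i)) (WL (i + j) p)"
  "WL i (WH j p) = WH j (WL i p) + fscale (of_int j) (WH (i + j) p)"
  "WH i (WH j p) = WH j (WH i p)"
  by (rule poly_mapping_eqI; simp add: lookup_intermediate_act lookup_add algebra_simps)+

text \<open>Linear on all of V(\<alpha>,\<beta>;F), but meaningful only on vectors supported in the
  half line, since nothing is known about \<open>w k\<close> for k < M. It commutes with operators
  of index i when both k and k + i are at least M for every key k.\<close>

definition realize :: "(int \<Rightarrow>\<^sub>0 complex) \<Rightarrow> 'v" where
  "realize p = (\<Sum>k\<in>Poly_Mapping.keys p. scale (Poly_Mapping.lookup p k) (w k))"

lemma realize_superset:
  "finite A \<Longrightarrow> Poly_Mapping.keys p \<subseteq> A \<Longrightarrow> realize p = (\<Sum>k\<in>A. scale (Poly_Mapping.lookup p k) (w k))"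
  unfolding realize_def by (rule sum.mono_neutral_left) (auto simp: in_keys_iff)

lemma realize_add: "realize (p + q) = realize p + realize q"
proof -
  let ?A = "Poly_Mapping.keys p \<union> Poly_Mapping.keys q"
  have "Poly_Mapping.keys (p + q) \<subseteq> ?A" by (rule Poly_Mapping.keys_add)
  then show ?thesis
    by (simp add: realize_superset[of ?A] lookup_add scale_left_distrib sum.distrib)
qed

lemma realize_scale: "realize (fscale z p) = scale z (realize p)"
  by (simp add: realize_superset[of "Poly_Mapping.keys p"] keys_fscale scale_sum_right)

lemma realize_zero: "realize 0 = 0"
  by (simp add: realize_def)

lemma L_sum: "L i (sum g A) = (\<Sum>a\<in>A. L i (g a))"
  by (induction A rule: infinite_finite_induct) (simp_all add: L_linear)

lemma H_sum: "H i (sum g A) = (\<Sum>a\<in>A. H i (g a))"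
  by (induction A rule: infinite_finite_induct) (simp_all add: H_linear)

lemma L_realize:
  assumes "Poly_Mapping.keys p \<subseteq> {max M (M - i)..}"
  shows "L i (realize p) = realize (WL i p)"
proof -
  let ?K = "Poly_Mapping.keys p"
  have "realize (WL i p) = (\<Sum>k\<in>(\<lambda>k. k + i) ` ?K. scale (Poly_Mapping.lookup (WL i p) k) (w k))"
    by (rule realize_superset) (auto simp: in_keys_iff lookup_intermediate_act intro!: image_eqI[of _ _ "_ - i"])
  also have "\<dots> = (\<Sum>k\<in>?K. scale (Poly_Mapping.lookup (WL i p) (k + i)) (w (k + i)))"
    by (rule sum.reindex_cong[OF _ refl]) (auto intro: inj_onI)
  also have "\<dots> = (\<Sum>k\<in>?K. L i (scale (Poly_Mapping.lookup p k) (w k)))"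
  proof (rule sum.cong[OF refl])
    fix k assume "k \<in> ?K"
    then have "k \<ge> M" "k + i \<ge> M" using assms by auto
    then show "scale (Poly_Mapping.lookup (WL i p) (k + i)) (w (k + i)) = L i (scale (Poly_Mapping.lookup p k) (w k))"
      by (simp add: lookup_intermediate_act L_linear L_w mult.commute)
  qed
  also have "\<dots> = L i (realize p)" by (simp add: realize_def L_sum)
  finally show ?thesis ..
qed

lemma H_realize:
  assumes "Poly_Mapping.keys p \<subseteq> {max M (M - i)..}"
  shows "H i (realize p) = realize (WH i p)"
proof -
  let ?K = "Poly_Mapping.keys p"
  have "realize (WH i p) = (\<Sum>k\<in>(\<lambda>k. k + i) ` ?K. scale (Poly_Mapping.lookup (WH i p) k) (w k))"
    by (rule realize_superset) (auto simp: in_keys_iff lookup_intermediate_act intro!: image_eqI[of _ _ "_ - i"])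
  also have "\<dots> = (\<Sum>k\<in>?K. scale (Poly_Mapping.lookup (WH i p) (k + i)) (w (k + i)))"
    by (rule sum.reindex_cong[OF _ refl]) (auto intro: inj_onI)
  also have "\<dots> = (\<Sum>k\<in>?K. H i (scale (Poly_Mapping.lookup p k) (w k)))"
  proof (rule sum.cong[OF refl])
    fix k assume "k \<in> ?K"
    then have "k \<ge> M" "k + i \<ge> M" using assms by auto
    then show "scale (Poly_Mapping.lookup (WH i p) (k + i)) (w (k + i)) = H i (scale (Poly_Mapping.lookup p k) (w k))"
      by (simp add: lookup_intermediate_act H_linear H_w mult.commute)
  qed
  also have "\<dots> = H i (realize p)" by (simp add: realize_def H_sum)
  finally show ?thesis ..
qed

text \<open>Distinct basis vectors have distinct weights: applying \<open>x_0\<close> minus the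
  weight of one key removes exactly this key from a relation, until a single nonzero vector is
  left.\<close>

lemma realize_inj: "realize p = 0 \<Longrightarrow> Poly_Mapping.keys p \<subseteq> {M..} \<Longrightarrow> p = 0"
proof (induction "card (Poly_Mapping.keys p)" arbitrary: p rule: less_induct)
  case less
  show ?case
  proof (rule ccontr)
    assume "p \<noteq> 0"
    then obtain k0 where k0: "k0 \<in> Poly_Mapping.keys p" by (metis all_not_in_conv keys_eq_empty)
    define p' where "p' = WL 0 p + fscale (- (\<alpha> + of_int k0)) p"
    have lk: "Poly_Mapping.lookup p' k = of_int (k - k0) * Poly_Mapping.lookup p k" for k
      by (simp add: p'_def lookup_add lookup_intermediate_act algebra_simps)
    have keys: "Poly_Mapping.keys p' = Poly_Mapping.keys p - {k0}"
      by (auto simp: in_keys_iff lk)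
    have "realize p' = L 0 (realize p) + scale (- (\<alpha> + of_int k0)) (realize p)"
      unfolding p'_def realize_add realize_scale using less.prems by (subst L_realize) auto
    then have "realize p' = 0" using less.prems by (simp add: L_linear)
    moreover have "card (Poly_Mapping.keys p') < card (Poly_Mapping.keys p)"
      unfolding keys by (rule card_Diff1_less) (use k0 in auto)
    moreover have "Poly_Mapping.keys p' \<subseteq> {M..}" using less.prems keys by auto
    ultimately have "p' = 0" using less.hyps by blast
    then have "Poly_Mapping.keys p = {k0}" using keys k0 by auto
    then have "scale (Poly_Mapping.lookup p k0) (w k0) = 0" using less.prems(1) by (simp add: realize_def)
    moreover have "Poly_Mapping.lookup p k0 \<noteq> 0" using k0 by (simp add: in_keys_iff)
    moreover have "w k0 \<noteq> 0" using k0 less.prems(2) by (intro w_nz) auto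
    ultimately show False by simp
  qed
qed

text \<open>A vector is determined by the images under $x_i$ and $I(i)$ for large $i$, which lie in the
  part of the module where it agrees with $V(\alpha,\beta;F)$. Comparing these images defines a
  submodule of the direct sum of the two modules; it is the graph of an embedding.\<close>

definition matches :: "'v \<Rightarrow> (int \<Rightarrow>\<^sub>0 complex) \<Rightarrow> bool" where
  "matches v p \<longleftrightarrow> (\<exists>B. \<forall>i\<ge>B. L i v = realize (WL i p) \<and> H i v = realize (WH i p))"

lemma matches_add:
  assumes "matches v p" "matches v' p'"
  shows "matches (v + v') (p + p')"
proof -
  obtain B B' where "\<forall>i\<ge>B. L i v = realize (WL i p) \<and> H i v = realize (WH i p)"
    "\<forall>i\<ge>B'. L i v' = realize (WL i p') \<and> H i v' = realize (WH i p')"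
    using assms unfolding matches_def by blast
  then have "\<forall>i\<ge>max B B'. L i (v + v') = realize (WL i (p + p')) \<and> H i (v + v') = realize (WH i (p + p'))"
    by (simp add: L_linear H_linear intermediate_act_linear realize_add)
  then show ?thesis unfolding matches_def by blast
qed

lemma matches_scale: "matches v p \<Longrightarrow> matches (scale z v) (fscale z p)"
  unfolding matches_def by (auto simp: L_linear H_linear intermediate_act_linear realize_scale)

lemma matches_zero: "matches 0 0"
  by (auto simp: matches_def L_linear H_linear intermediate_act_simps realize_zero)

text \<open>Commuting the operator of large index i past the one of index j leaves terms in which an
  operator of large index meets v directly. These are known from the hypothesis and lie so far to
  the right that \<open>L_realize\<close> and \<open>H_realize\<close> apply to index j.\<close>

lemma matches_act:
  assumes "matches v p"
  shows "matches (L j v) (WL j p)" "matches (H j v) (WH j p)"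
proof -
  obtain B where B: "\<And>i. i \<ge> B \<Longrightarrow> L i v = realize (WL i p)" "\<And>i. i \<ge> B \<Longrightarrow> H i v = realize (WH i p)"
    using assms unfolding matches_def by blast
  obtain B' where B': "\<And>i. i \<ge> B' \<Longrightarrow> Poly_Mapping.keys (WL i p) \<subseteq> {max M (M - j)..}"
     "\<And>i. i \<ge> B' \<Longrightarrow> Poly_Mapping.keys (WH i p) \<subseteq> {max M (M - j)..}"
    using eventually_keys_ge by blast
  have "L i (L j v) = realize (WL i (WL j p)) \<and> H i (L j v) = realize (WH i (WL j p)) \<and>
    L i (H j v) = realize (WL i (WH j p)) \<and> H i (H j v) = realize (WH i (WH j p))" if i: "i \<ge> max (max B (B - j)) B'" for i
  proof -
    have i': "i \<ge> B" "i + j \<ge> B" "j + i \<ge> B" "i \<ge> B'" using i by auto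
    note TT = realize_add[symmetric] realize_scale[symmetric] L_realize[OF B'(1)[OF i'(4)]] L_realize[OF B'(2)[OF i'(4)]]
      H_realize[OF B'(1)[OF i'(4)]] H_realize[OF B'(2)[OF i'(4)]]
    have "L i (L j v) = L j (realize (WL i p)) + scale (of_int (j - i)) (realize (WL (i + j) p))"
      using LL[of i j v] i' B by simp
    also have "\<dots> = realize (WL i (WL j p))" unfolding TT W_relations(1)[of i j] ..
    finally have 1: "L i (L j v) = realize (WL i (WL j p))" .
    have "L i (H j v) = H j (realize (WL i p)) + scale (of_int j) (realize (WH (i + j) p))"
      using LH[of i j v] i' B by simp
    also have "\<dots> = realize (WL i (WH j p))" unfolding TT W_relations(2)[of i j] ..
    finally have 2: "L i (H j v) = realize (WL i (WH j p))" .
    have "H i (H j v) = H j (realize (WH i p))"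
      using HH[of i j v] i' B by simp
    also have "\<dots> = realize (WH i (WH j p))" unfolding TT W_relations(3)[of i j] ..
    finally have 3: "H i (H j v) = realize (WH i (WH j p))" .
    \<comment> \<open>\<open>LH\<close> is used with the indices exchanged and solved for the other
      order of the two operators.\<close>
    have "L j (realize (WH i p)) = H i (L j v) + scale (of_int i) (realize (WH (j + i) p))"
      using LH[of j i v] i' B by simp
    then have "realize (WH i (WL j p)) + scale (of_int i) (realize (WH (j + i) p)) = H i (L j v) + scale (of_int i) (realize (WH (j + i) p))"
      unfolding TT W_relations(2)[of j i] by simp
    then have "H i (L j v) = realize (WH i (WL j p))" by simp
    with 1 2 3 show ?thesis by blast
  qed
  then show "matches (L j v) (WL j p)" "matches (H j v) (WH j p)" unfolding matches_def by blast+
qed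

lemma matches_w:
  assumes n: "n \<ge> M"
  shows "matches (w n) (Poly_Mapping.single n 1)"
proof -
  have "L i (w n) = realize (WL i (Poly_Mapping.single n 1)) \<and> H i (w n) = realize (WH i (Poly_Mapping.single n 1))"
    if "i \<ge> 0" for i
  proof -
    have realize: "realize (Poly_Mapping.single n 1) = w n" by (simp add: realize_def)
    have "Poly_Mapping.keys (Poly_Mapping.single n (1::complex)) \<subseteq> {max M (M - i)..}" using n that by simp
    from L_realize[OF this] H_realize[OF this] show ?thesis by (simp add: realize)
  qed
  then show ?thesis unfolding matches_def by blast
qed

text \<open>The vectors matching 0 form a submodule. It does not contain \<open>w M\<close>: two
  consecutive large indices would give F = \<beta> = 0. Irreducibility leaves only {0}.\<close>

lemma matches_right_zero:
  assumes "matches v 0"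
  shows "v = 0"
proof -
  let ?U = "{v. matches v 0}"
  have z: "WL i 0 = 0" "WH i 0 = 0" for i by (simp_all add: intermediate_act_simps)
  have "?U = {0} \<or> ?U = UNIV"
  proof (rule irreducible)
    show "subspace ?U"
      unfolding subspace_def using matches_add[of _ 0 _ 0] matches_scale[of _ 0] matches_zero by simp
  qed (use matches_act[of _ 0] in \<open>simp_all add: z\<close>)
  moreover have "\<not> matches (w M) 0"
  proof
    assume "matches (w M) 0"
    then obtain B where B: "\<And>i. i \<ge> B \<Longrightarrow> L i (w M) = 0" "\<And>i. i \<ge> B \<Longrightarrow> H i (w M) = 0"
      by (auto simp: matches_def z realize_zero)
    define i where "i = max B 0"
    have nz: "w (M + i) \<noteq> 0" "w (M + (i + 1)) \<noteq> 0" using w_nz by (simp_all add: i_def)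
    have "F = 0" using B(2)[of i] H_w[of M i] nz by (simp add: i_def)
    have "\<alpha> + of_int M + \<beta> * of_int i = 0" "\<alpha> + of_int M + \<beta> * of_int (i + 1) = 0"
      using B(1)[of i] B(1)[of "i + 1"] L_w[of M i] L_w[of M "i + 1"] nz by (simp_all add: i_def)
    then have "\<beta> = 0" by (simp add: algebra_simps)
    with \<open>F = 0\<close> \<beta>F show False by simp
  qed
  ultimately have "?U = {0}" by blast
  with assms show ?thesis by blast
qed

text \<open>V(\<alpha>,\<beta>;F) may be reducible, so coefficients are compared instead. For large
  i the images of p lie where \<open>realize\<close> is injective, hence vanish, and a nonzero
  coefficient of p would again force F = \<beta> = 0.\<close>

lemma matches_left_zero:
  assumes "matches 0 p"
  shows "p = 0"
proof -
  obtain B where B: "\<And>i. i \<ge> B \<Longrightarrow> realize (WL i p) = 0" "\<And>i. i \<ge> B \<Longrightarrow> realize (WH i p) = 0"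
    using assms unfolding matches_def L_linear H_linear by metis
  obtain B' where B': "\<And>i. i \<ge> B' \<Longrightarrow> Poly_Mapping.keys (WL i p) \<subseteq> {M..}"
     "\<And>i. i \<ge> B' \<Longrightarrow> Poly_Mapping.keys (WH i p) \<subseteq> {M..}"
    using eventually_keys_ge by blast
  define i where "i = max B B'"
  have "WL i p = 0" "WL (i + 1) p = 0" "WH i p = 0"
    by (intro realize_inj B B'; simp add: i_def)+
  then have "Poly_Mapping.lookup (WL i p) (k + i) = 0" "Poly_Mapping.lookup (WL (i + 1) p) (k + (i + 1)) = 0"
    "Poly_Mapping.lookup (WH i p) (k + i) = 0" for k by simp_all
  then have *: "(\<alpha> + of_int k + \<beta> * of_int i) * Poly_Mapping.lookup p k = 0"
    "(\<alpha> + of_int k + \<beta> * of_int (i + 1)) * Poly_Mapping.lookup p k = 0"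
    "F * Poly_Mapping.lookup p k = 0" for k
    by (simp_all add: lookup_intermediate_act)
  have "Poly_Mapping.lookup p k = 0" for k
  proof (rule ccontr)
    assume "Poly_Mapping.lookup p k \<noteq> 0"
    with *[of k] have "F = 0" "\<alpha> + of_int k + \<beta> * of_int i = 0" "\<alpha> + of_int k + \<beta> * of_int (i + 1) = 0"
      by auto
    then have "F = 0" "\<beta> = 0" by (simp_all add: algebra_simps)
    with \<beta>F show False by simp
  qed
  then show ?thesis by (intro poly_mapping_eqI) simp
qed

lemma matches_diff: "matches v p \<Longrightarrow> matches v' p' \<Longrightarrow> matches (v - v') (p - p')"
proof -
  assume "matches v p" "matches v' p'"
  then have "matches (v + scale (- 1) v') (p + fscale (- 1) p')" by (intro matches_add matches_scale)
  moreover have "p + fscale (- 1) p' = p - p'" by (rule poly_mapping_eqI) (simp add: lookup_add lookup_minus)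
  ultimately show ?thesis by simp
qed

text \<open>The vectors with a partner form a submodule containing the nonzero vector
  \<open>w M\<close>.\<close>

lemma matches_total: "\<exists>p. matches v p"
proof -
  let ?U = "{v. \<exists>p. matches v p}"
  have "?U = {0} \<or> ?U = UNIV"
    by (rule irreducible) (auto simp: subspace_def intro: matches_zero matches_add matches_scale matches_act)
  moreover have "w M \<in> ?U" "w M \<noteq> 0" using matches_w[of M] w_nz[of M] by auto
  ultimately show ?thesis by blast
qed

section \<open>The embedding and its image\<close>

definition embed :: "'v \<Rightarrow> (int \<Rightarrow>\<^sub>0 complex)" where
  "embed v = (THE p. matches v p)"

lemma embed_eq: "embed v = p \<longleftrightarrow> matches v p"
proof -
  have uniq: "p = q" if "matches v p" "matches v q" for p q
    using matches_left_zero matches_diff[OF that] by fastforce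
  from matches_total obtain q where q: "matches v q" by blast
  then have "embed v = q" unfolding embed_def using uniq by blast
  with q uniq show ?thesis by blast
qed

lemma embed_hom:
  "embed (u + v) = embed u + embed v" "embed (scale z v) = fscale z (embed v)"
  "embed (L i v) = WL i (embed v)" "embed (H i v) = WH i (embed v)"
  using matches_add matches_scale matches_act embed_eq by metis+

lemma inj_embed: "inj embed"
proof (rule injI)
  fix u v assume "embed u = embed v"
  then have "matches (u - v) 0" using matches_diff embed_eq by (metis diff_self)
  then show "u = v" using matches_right_zero by fastforce
qed

text \<open>The n-th basis vector is reached from the half line. If F is nonzero,
  \<open>I(n - M)\<close> does it; otherwise \<open>x_{n-k}\<close> does it with the coefficient
  \<alpha> + k + \<beta>(n - k), which is affine in k and vanishes for all k \<ge> M only if \<beta>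
  = 1 and \<alpha> + n = 0.\<close>

lemma single_in_range:
  assumes "F \<noteq> 0 \<or> \<beta> \<noteq> 1 \<or> \<alpha> + of_int n \<noteq> 0"
  shows "Poly_Mapping.single n 1 \<in> range embed"
proof -
  have scaled: "Poly_Mapping.single n 1 \<in> range embed" if "Poly_Mapping.single n z \<in> range embed" "z \<noteq> 0" for z
  proof -
    obtain v where "embed v = Poly_Mapping.single n z" using \<open>_ \<in> range embed\<close> by (metis imageE)
    then have "embed (scale (inverse z) v) = Poly_Mapping.single n 1"
      using \<open>z \<noteq> 0\<close> by (simp add: embed_hom)
    then show ?thesis by (metis rangeI)
  qed
  have w: "embed (w k) = Poly_Mapping.single k 1" if "k \<ge> M" for k
    using matches_w[OF that] embed_eq by blast
  show ?thesis
  proof (cases "F = 0")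
    case False
    have "embed (H (n - M) (w M)) = Poly_Mapping.single n F"
      by (simp add: embed_hom w intermediate_act_simps)
    with False show ?thesis by (metis scaled rangeI)
  next
    case True
    have *: "embed (L (n - k) (w k)) = Poly_Mapping.single n (\<alpha> + of_int k + \<beta> * of_int (n - k))" if "k \<ge> M" for k
      by (simp add: embed_hom w[OF that] intermediate_act_simps)
    have "\<exists>k\<ge>M. \<alpha> + of_int k + \<beta> * of_int (n - k) \<noteq> 0"
    proof (rule ccontr)
      assume "\<not> ?thesis"
      then have z: "\<alpha> + of_int k + \<beta> * of_int (n - k) = 0" if "k \<ge> M" for k using that by blast
      have "1 - \<beta> = 0" using z[of M] z[of "M + 1"] by (simp add: algebra_simps)
      moreover from this z[of M] have "\<alpha> + of_int n = 0" by (simp add: algebra_simps)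
      ultimately show False using assms True by simp
    qed
    then show ?thesis by (metis * scaled rangeI)
  qed
qed

lemma in_support:
  assumes "F \<noteq> 0 \<or> \<beta> \<noteq> 1 \<or> \<alpha> + of_int n \<noteq> 0"
  shows "n \<in> support"
proof -
  obtain v where v: "embed v = Poly_Mapping.single n 1" using single_in_range[OF assms] by (metis imageE)
  have "embed (L 0 v) = embed (scale (\<alpha> + of_int n) v)"
    by (simp add: embed_hom v intermediate_act_simps)
  then have "L 0 v = scale (\<alpha> + of_int n) v" using inj_embed by (metis injD)
  moreover have "v \<noteq> 0"
  proof
    assume "v = 0"
    then have "embed v = 0" using matches_zero embed_eq by blast
    with v show False by (metis lookup_single_eq lookup_zero zero_neq_one)
  qed
  ultimately show ?thesis by (auto simp: support_def E_def)
qed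

text \<open>At most one basis vector can be missing, and the choice of \<alpha> in its coset puts it
  at index 0. The image then contains \<open>V_prime\<close>, which has codimension one, so nothing
  lies strictly in between.\<close>

lemma range_embed:
  assumes int: "\<alpha> \<in> \<int> \<Longrightarrow> \<alpha> = 0"
  shows "range embed = UNIV \<or> (\<alpha> = 0 \<and> \<beta> = 1 \<and> F = 0 \<and> range embed = V_prime)"
proof -
  interpret W: vector_space "fscale :: complex \<Rightarrow> (int \<Rightarrow>\<^sub>0 complex) \<Rightarrow> _"
    by (rule vector_space_fscale)
  have "embed 0 = 0" using matches_zero embed_eq by blast
  then have sub: "W.subspace (range embed)"
    by (auto simp: W.subspace_def image_iff) (metis embed_hom(1), metis embed_hom(2))
  have full: "range embed = UNIV" if "\<And>k. Poly_Mapping.single k 1 \<in> range embed"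
  proof -
    have "p \<in> range embed" for p
    proof (induction p rule: poly_mapping_basis_induct)
      case (single a z)
      from W.subspace_scale[OF sub that[of a], of z] show ?case by simp
    qed (use W.subspace_0[OF sub] W.subspace_add[OF sub] in auto)
    then show ?thesis by blast
  qed
  show ?thesis
  proof (cases "F \<noteq> 0 \<or> \<beta> \<noteq> 1 \<or> (\<forall>n. \<alpha> + of_int n \<noteq> 0)")
    case True
    then show ?thesis using single_in_range full by blast
  next
    case False
    then obtain n where n: "F = 0" "\<beta> = 1" "\<alpha> + of_int n = 0" by blast
    then have "\<alpha> = of_int (- n)" by (simp add: eq_neg_iff_add_eq_0)
    with int have \<alpha>: "\<alpha> = 0" by (metis Ints_of_int)
    have sng: "Poly_Mapping.single k 1 \<in> range embed" if "k \<noteq> 0" for k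
      using that \<alpha> by (intro single_in_range) simp
    have sup: "V_prime \<subseteq> range embed"
      unfolding V_prime_def using sng by (intro W.span_minimal sub) auto
    show ?thesis
    proof (cases "range embed = V_prime")
      case False
      then obtain v where v: "embed v \<notin> V_prime" using sup by blast
      let ?z = "Poly_Mapping.lookup (embed v) 0"
      have mem: "p \<in> V_prime" if "Poly_Mapping.lookup p 0 = 0" for p
      proof -
        have "p = (\<Sum>k\<in>Poly_Mapping.keys p. fscale (Poly_Mapping.lookup p k) (Poly_Mapping.single k 1))"
          by (rule poly_mapping_eqI) (simp add: lookup_sum lookup_single when_def in_keys_iff)
        moreover have "\<dots> \<in> V_prime"
          unfolding V_prime_def using that
          by (intro W.span_sum W.span_scale W.span_base) (auto simp: in_keys_iff)
        ultimately show ?thesis by simp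
      qed
      have z: "?z \<noteq> 0" using v mem by blast
      have "embed v - fscale ?z (Poly_Mapping.single 0 1) \<in> V_prime"
        by (rule mem) (simp add: lookup_minus)
      then have "embed v - (embed v - fscale ?z (Poly_Mapping.single 0 1)) \<in> range embed"
        by (rule W.subspace_diff[OF sub rangeI subsetD[OF sup]])
      then have "fscale ?z (Poly_Mapping.single 0 1) \<in> range embed"
        by (simp only: diff_diff_eq2 add_diff_cancel_left')
      then have "fscale (inverse ?z) (fscale ?z (Poly_Mapping.single 0 1)) \<in> range embed"
        by (rule W.subspace_scale[OF sub])
      then have "Poly_Mapping.single 0 1 \<in> range embed" using z by simp
      with sng full show ?thesis by metis
    qed (use n \<alpha> in simp)
  qed
qed

end

context hv_weight_rep begin

text \<open>If only a left half line were available, the reflected module would have a right one and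
  hence an embedding. By \<open>in_support\<close> that module then has all weights but at most one,
  so the right half line exists after all.\<close>

lemma tail_above: "\<exists>N. \<forall>n\<ge>N. n \<in> support"
proof (rule ccontr)
  assume neg: "\<not> ?thesis"
  interpret R: hv_weight_rep scale "\<lambda>i v. - L (- i) v"
     "\<lambda>i v. H (- i) v + scale (if i = 0 then - 2 * d else 0) v" "- c" "- d" "- e" "F - 2 * d" "- \<alpha>"
    by (rule weyl_flip)
  obtain N where N: "\<And>n. n \<le> N \<Longrightarrow> n \<in> support" using support_tail neg by blast
  have "- n \<in> support" if "n \<ge> - N" for n using N that by simp
  then have "\<forall>n\<ge>- N. n \<in> R.support" unfolding support_flip by blast
  then obtain M \<beta> w where "hv_tail scale (\<lambda>i v. - L (- i) v)
     (\<lambda>i v. H (- i) v + scale (if i = 0 then - 2 * d else 0) v) (F - 2 * d) (- \<alpha>) M \<beta> w"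
    using R.tail_normal_form by blast
  then interpret Q: hv_tail scale "\<lambda>i v. - L (- i) v"
     "\<lambda>i v. H (- i) v + scale (if i = 0 then - 2 * d else 0) v" "F - 2 * d" "- \<alpha>" M \<beta> w .
  \<comment> \<open>Beyond |Re \<alpha>| the weight cannot be 0, the only value that may be
    absent.\<close>
  define B where "B = \<lceil>\<bar>Re \<alpha>\<bar>\<rceil> + 1"
  have "n \<in> support" if "n \<ge> B" for n
  proof -
    have "Re (- \<alpha> + of_int (- n)) \<noteq> 0" using that unfolding B_def by simp linarith
    then have "- \<alpha> + of_int (- n) \<noteq> 0" by (metis zero_complex.sel(1))
    then have "- n \<in> R.support" by (intro Q.in_support) blast
    then show ?thesis unfolding support_flip by simp
  qed
  with neg show False by blast
qed

theorem embedding_exists: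
  assumes int: "\<alpha> \<in> \<int> \<Longrightarrow> \<alpha> = 0"
  obtains \<beta> f where "c = 0" "d = 0" "e = 0" "inj f"
    "\<And>u v. f (u + v) = f u + f v" "\<And>z v. f (scale z v) = fscale z (f v)"
    "\<And>i v. f (L i v) = intermediate_act \<alpha> \<beta> F (hv_basis (X i)) (f v)"
    "\<And>i v. f (H i v) = intermediate_act \<alpha> \<beta> F (hv_basis (I i)) (f v)"
    "range f = UNIV \<or> (\<alpha> = 0 \<and> \<beta> = 1 \<and> F = 0 \<and> range f = V_prime)"
proof -
  obtain N where "\<forall>n\<ge>N. n \<in> support" using tail_above by blast
  then obtain M \<beta> w where 0: "c = 0" "d = 0" "e = 0" and "hv_tail scale L H F \<alpha> M \<beta> w"
    using tail_normal_form by blast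
  then interpret Q: hv_tail scale L H F \<alpha> M \<beta> w by blast
  show thesis
    by (rule that[OF 0 Q.inj_embed Q.embed_hom Q.range_embed[OF int]])
qed

end


section \<open>Modules over the twisted Heisenberg-Virasoro algebra\<close>

locale hv_rep = lie_module fscale hv_bracket scale act
  for scale :: "complex \<Rightarrow> 'v::ab_group_add \<Rightarrow> 'v" and act :: "hv \<Rightarrow> 'v \<Rightarrow> 'v"
begin

lemma act_left:
  "act (x + y) v = act x v + act y v" "act (fscale z x) v = scale z (act x v)" "act 0 v = 0"
proof -
  interpret l: Vector_Spaces.linear fscale scale "\<lambda>x. act x v" by (rule linear_act_left)
  show "act (x + y) v = act x v + act y v" "act (fscale z x) v = scale z (act x v)" "act 0 v = 0"
    by (rule l.add l.scale l.zero)+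
qed

lemma act_right:
  "act x (u + v) = act x u + act x v" "act x (scale z v) = scale z (act x v)" "act x 0 = 0"
proof -
  interpret l: Vector_Spaces.linear scale scale "act x" by (rule linear_act_right)
  show "act x (u + v) = act x u + act x v" "act x (scale z v) = scale z (act x v)" "act x 0 = 0"
    by (rule l.add l.scale l.zero)+
qed

lemma act_single: "act (Poly_Mapping.single a z) v = scale z (act (hv_basis a) v)"
  using act_left(2)[of z "hv_basis a" v] by simp

lemma act_in_subspace:
  assumes "V.subspace U" "\<And>a. act (hv_basis a) v \<in> U"
  shows "act x v \<in> U"
proof (induction x rule: poly_mapping_basis_induct)
  case (single a z)
  show ?case unfolding act_single[of a z v] using assms by (intro V.subspace_scale)
qed (use assms in \<open>auto simp: act_left intro: V.subspace_0 V.subspace_add\<close>)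

lemma commute:
  "act (hv_basis a) (act (hv_basis b) v) = act (hv_basis b) (act (hv_basis a) v) + act (hv_bracket_basis a b) v"
  using act_bracket[of "hv_basis a" "hv_basis b" v] by (simp add: hv_bracket_simps)

lemma commute_XX:
  "act (hv_basis (X i)) (act (hv_basis (X j)) v) = act (hv_basis (X j)) (act (hv_basis (X i)) v)
     + scale (of_int (j - i)) (act (hv_basis (X (i + j))) v)
     + scale (if i = - j then (of_int i ^ 3 - of_int i) / 12 else 0) (act (hv_basis C_D) v)"
  unfolding commute[of "X i" "X j"] hv_bracket_basis.simps act_left by simp

lemma commute_XI:
  "act (hv_basis (X i)) (act (hv_basis (I j)) v) = act (hv_basis (I j)) (act (hv_basis (X i)) v)
     + scale (of_int j) (act (hv_basis (I (i + j))) v)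
     + scale (if i = - j then of_int i ^ 2 + of_int i else 0) (act (hv_basis C_DI) v)"
  unfolding commute[of "X i" "I j"] hv_bracket_basis.simps act_left by simp

lemma commute_II:
  "act (hv_basis (I i)) (act (hv_basis (I j)) v) = act (hv_basis (I j)) (act (hv_basis (I i)) v)
     + scale (if i = - j then of_int i else 0) (act (hv_basis C_I) v)"
  unfolding commute[of "I i" "I j"] hv_bracket_basis.simps act_left by simp

lemma commute_central:
  assumes "z \<in> {C_D, C_DI, C_I}"
  shows "act (hv_basis z) (act (hv_basis a) v) = act (hv_basis a) (act (hv_basis z) v)"
  unfolding commute[of z a] using assms by (cases a) (auto simp: act_left)

section \<open>Reduction to one lattice of weights\<close>

lemma weight_step:
  assumes v: "v \<in> weight_space scale act (l, l', c, d, e)"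
  shows "act (hv_basis (X i)) v \<in> weight_space scale act (l + of_int i, l', c, d, e)"
    and "act (hv_basis (I i)) v \<in> weight_space scale act (l + of_int i, l', c, d, e)"
proof -
  have w: "act (hv_basis (X 0)) v = scale l v" "act (hv_basis (I 0)) v = scale l' v"
    "act (hv_basis C_D) v = scale c v" "act (hv_basis C_DI) v = scale d v" "act (hv_basis C_I) v = scale e v"
    using v by (auto simp: weight_space_def)
  note central = commute_central[of C_D, simplified] commute_central[of C_DI, simplified]
    commute_central[of C_I, simplified]
  show "act (hv_basis (X i)) v \<in> weight_space scale act (l + of_int i, l', c, d, e)"
    using commute_XX[of 0 i v] commute_XI[of i 0 v]
    by (simp add: weight_space_def central w act_right V.scale_left_distrib)
  show "act (hv_basis (I i)) v \<in> weight_space scale act (l + of_int i, l', c, d, e)"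
    using commute_XI[of 0 i v] commute_II[of i 0 v]
    by (simp add: weight_space_def central w act_right V.scale_left_distrib)
qed

text \<open>Basis elements shift the eigenvalue of \<open>x_0\<close> by integers and preserve the
  other four, so the span is a nonzero submodule.\<close>

lemma weight_lattice_spans:
  assumes irr: "irreducible_module scale act"
    and v0: "v0 \<in> weight_space scale act (\<alpha> + of_int n0, l', c, d, e)" "v0 \<noteq> 0"
  shows "V.span (\<Union>n::int. weight_space scale act (\<alpha> + of_int n, l', c, d, e)) = UNIV"
proof -
  define S where "S = (\<Union>n::int. weight_space scale act (\<alpha> + of_int n, l', c, d, e))"
  have basis: "act (hv_basis a) v \<in> V.span S" if v: "v \<in> S" for a v
  proof -
    obtain n where n: "v \<in> weight_space scale act (\<alpha> + of_int n, l', c, d, e)" using v by (auto simp: S_def)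
    have "\<alpha> + complex_of_int n + of_int i = \<alpha> + of_int (n + i)" for i by simp
    then have up: "u \<in> S" if "u \<in> weight_space scale act (\<alpha> + of_int n + of_int i, l', c, d, e)" for u i
      unfolding S_def using that by (metis UNIV_I UN_I)
    have "act (hv_basis C_D) v = scale c v" "act (hv_basis C_DI) v = scale d v" "act (hv_basis C_I) v = scale e v"
      using n by (auto simp: weight_space_def)
    then show ?thesis
      using up[OF weight_step(1)[OF n]] up[OF weight_step(2)[OF n]] v
      by (cases a) (auto intro: V.span_base V.span_scale)
  qed
  have gen: "act x v \<in> V.span S" if v: "v \<in> S" for x v
    by (rule act_in_subspace[OF V.subspace_span basis[OF v]])
  have "act x v \<in> V.span S" if "v \<in> V.span S" for x v
    using that
    by (induction rule: V.span_induct_alt) (simp_all add: act_right gen V.span_zero V.span_add V.span_scale)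
  then have "submodule scale act (V.span S)" by (simp add: submodule_def)
  then have "V.span S = {0} \<or> V.span S = UNIV" using irr unfolding irreducible_module_def by blast
  moreover have "v0 \<in> V.span S" unfolding S_def using v0 by (intro V.span_base) blast
  ultimately show ?thesis using v0 unfolding S_def by blast
qed

lemma weight_space_proportional:
  assumes "weight_multiplicity_one scale act"
    and "u \<in> weight_space scale act w" "v \<in> weight_space scale act w" "u \<noteq> 0"
  shows "\<exists>a. v = scale a u"
proof -
  have dim: "V.dim (weight_space scale act w) = 1"
    using assms unfolding weight_multiplicity_one_def by blast
  obtain B where B: "weight_space scale act w \<subseteq> V.span B" "card B = 1"
    using V.basis_exists[of "weight_space scale act w"] dim by metis
  then obtain b where "B = {b}" by (metis card_1_singletonE)
  with B(1) assms(2,3) have "u \<in> V.span {b}" "v \<in> V.span {b}" by auto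
  then obtain p q where "u = scale p b" "v = scale q b" unfolding V.span_singleton by blast
  then have "v = scale (q / p) u" using assms(4) by auto
  then show ?thesis ..
qed

text \<open>Since one lattice spans V, \<open>I(0)\<close> and the central elements act by scalars
  everywhere. The weight spaces in the lattice are therefore plain eigenspaces of
  \<open>x_0\<close>, and multiplicity one becomes a statement about \<open>x_0\<close>
  alone.\<close>

lemma weight_rep:
  assumes irr: "irreducible_module scale act"
    and nt: "\<not> trivial_module act"
    and mult: "weight_multiplicity_one scale act"
    and v0: "v0 \<in> weight_space scale act (\<alpha> + of_int n0, l', c, d, e)" "v0 \<noteq> 0"
  shows "hv_weight_rep scale (\<lambda>i. act (hv_basis (X i))) (\<lambda>i. act (hv_basis (I i))) c d e l' \<alpha>"
    and "act (hv_basis C_D) v = scale c v" "act (hv_basis C_DI) v = scale d v" "act (hv_basis C_I) v = scale e v"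
proof -
  note spans = weight_lattice_spans[OF irr v0]
  have eigen: "act (hv_basis a) v = scale z v"
    if "\<And>n v. v \<in> weight_space scale act (\<alpha> + of_int n, l', c, d, e) \<Longrightarrow> act (hv_basis a) v = scale z v" for a z v
  proof -
    have "V.subspace {v. act (hv_basis a) v = scale z v}"
      by (auto simp: V.subspace_def act_right V.scale_right_distrib V.scale_left_commute)
    then have "V.span (\<Union>n::int. weight_space scale act (\<alpha> + of_int n, l', c, d, e)) \<subseteq> {v. act (hv_basis a) v = scale z v}"
      using that by (intro V.span_minimal) auto
    then show ?thesis unfolding spans by blast
  qed
  have central: "act (hv_basis C_D) v = scale c v" "act (hv_basis C_DI) v = scale d v"
    "act (hv_basis C_I) v = scale e v" "act (hv_basis (I 0)) v = scale l' v" for v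
    by (rule eigen; simp add: weight_space_def)+
  then show "act (hv_basis C_D) v = scale c v" "act (hv_basis C_DI) v = scale d v" "act (hv_basis C_I) v = scale e v"
    by blast+
  have ws: "v \<in> weight_space scale act (\<alpha> + of_int n, l', c, d, e) \<longleftrightarrow> act (hv_basis (X 0)) v = scale (\<alpha> + of_int n) v"
    for v n by (simp add: weight_space_def central)
  show "hv_weight_rep scale (\<lambda>i. act (hv_basis (X i))) (\<lambda>i. act (hv_basis (I i))) c d e l' \<alpha>"
  proof (intro hv_weight_rep.intro V.vector_space_axioms hv_weight_rep_axioms.intro)
    fix U assume U: "V.subspace U" "\<And>i v. v \<in> U \<Longrightarrow> act (hv_basis (X i)) v \<in> U"
      "\<And>i v. v \<in> U \<Longrightarrow> act (hv_basis (I i)) v \<in> U"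
    have "act (hv_basis a) v \<in> U" if v: "v \<in> U" for a v
      by (cases a) (use U(2,3)[OF v] V.subspace_scale[OF U(1) v] in \<open>simp_all add: central\<close>)
    then have "act x v \<in> U" if v: "v \<in> U" for x v
      using act_in_subspace[OF U(1)] v by blast
    with U(1) have "submodule scale act U" by (simp add: submodule_def)
    then show "U = {0} \<or> U = UNIV" using irr unfolding irreducible_module_def by blast
  next
    fix u n v assume "act (hv_basis (X 0)) u = scale (\<alpha> + of_int n) u" "act (hv_basis (X 0)) v = scale (\<alpha> + of_int n) v" "u \<noteq> 0"
    then show "\<exists>a. v = scale a u" using weight_space_proportional[OF mult] unfolding ws[symmetric] by blast
  next
    show "V.span {v. \<exists>n. act (hv_basis (X 0)) v = scale (\<alpha> + of_int n) v} = UNIV"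
      using spans unfolding ws[symmetric] by (simp add: UNION_eq)
    show "\<exists>i v. act (hv_basis (X i)) v \<noteq> 0 \<or> act (hv_basis (I i)) v \<noteq> 0"
    proof (rule ccontr)
      assume "\<not> ?thesis"
      then have z: "act (hv_basis (X i)) v = 0" "act (hv_basis (I i)) v = 0" for i v by blast+
      \<comment> \<open>The index pairs are chosen where the cocycles are nonzero, with values 1/2,
        2 and 1, so the central elements act as 0 once all \<open>x_i\<close> and
        \<open>I(i)\<close> do.\<close>
      have "act (hv_basis C_D) v = 0" "act (hv_basis C_DI) v = 0" "act (hv_basis C_I) v = 0" for v
        using commute_XX[of 2 "- 2" v] commute_XI[of 1 "- 1" v] commute_II[of 1 "- 1" v] by (simp_all add: z)
      then have "act (hv_basis a) v = 0" for a v by (cases a) (simp_all add: z)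
      then have "act x v = 0" for x v
        using act_in_subspace[of "{0}" v x] by (simp add: V.subspace_def)
      moreover have "\<exists>v::'v. v \<noteq> 0" using v0 by blast
      ultimately show False using nt unfolding trivial_module_def by blast
    qed
  next
    fix i j v
    show "act (hv_basis (X i)) (act (hv_basis (X j)) v) = act (hv_basis (X j)) (act (hv_basis (X i)) v)
        + scale (of_int (j - i)) (act (hv_basis (X (i + j))) v)
        + scale (if i = - j then (of_int i ^ 3 - of_int i) / 12 * c else 0) v"
      unfolding commute_XX[of i j v] by (simp add: central)
    show "act (hv_basis (X i)) (act (hv_basis (I j)) v) = act (hv_basis (I j)) (act (hv_basis (X i)) v)
        + scale (of_int j) (act (hv_basis (I (i + j))) v)
        + scale (if i = - j then (of_int i ^ 2 + of_int i) * d else 0) v"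
      unfolding commute_XI[of i j v] by (simp add: central)
    show "act (hv_basis (I i)) (act (hv_basis (I j)) v) = act (hv_basis (I j)) (act (hv_basis (I i)) v)
        + scale (if i = - j then of_int i * e else 0) v"
      unfolding commute_II[of i j v] by (simp add: central)
  qed (rule linear_act_right central)+
qed

end

lemma intermediate_act_central:
  assumes "z \<in> {C_D, C_DI, C_I}"
  shows "intermediate_act \<alpha> \<beta> F (hv_basis z) p = 0"
  by (induction p rule: poly_mapping_basis_induct) (use assms in \<open>auto simp: intermediate_act_simps\<close>)

theorem theorem3p3:
  fixes scale :: "complex \<Rightarrow> 'v::ab_group_add \<Rightarrow> 'v"
    and act :: "hv \<Rightarrow> 'v \<Rightarrow> 'v"
  assumes "hv_module scale act"
    and "irreducible_module scale act"
    and "\<not> trivial_module act"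
    and "weight_module scale act"
    and "weight_multiplicity_one scale act"
  shows "(\<exists>\<alpha> \<beta> F. module_isomorphic scale act UNIV fscale (intermediate_act \<alpha> \<beta> F) UNIV)
       \<or> module_isomorphic scale act UNIV fscale (intermediate_act 0 1 0) V_prime"
proof -
  interpret hv_rep scale act using assms(1) by (simp add: hv_rep_def)
  have "\<exists>w v. v \<in> weight_space scale act w \<and> v \<noteq> 0"
  proof (rule ccontr)
    assume "\<not> ?thesis"
    then have "V.span (\<Union>w. weight_space scale act w) \<subseteq> {0}"
      by (intro V.span_minimal) (auto simp: V.subspace_def)
    then have "(UNIV :: 'v set) \<subseteq> {0}" using assms(4) by (simp add: weight_module_def)
    with assms(2) show False by (auto simp: irreducible_module_def)
  qed
  then obtain l F c d e v0 where v0: "v0 \<in> weight_space scale act (l, F, c, d, e)" "v0 \<noteq> 0"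
    by (metis prod_cases5)
  \<comment> \<open>Integral weights get the representative 0, so that the exceptional case is
    exactly V(0,1;0) with \<open>V_prime\<close> inside it.\<close>
  define \<alpha> where "\<alpha> = (if l \<in> \<int> then 0 else l)"
  have int: "\<alpha> \<in> \<int> \<Longrightarrow> \<alpha> = 0" by (auto simp: \<alpha>_def split: if_splits)
  have "\<exists>n. l = \<alpha> + of_int n"
  proof (cases "l \<in> \<int>")
    case True
    then show ?thesis by (auto simp: \<alpha>_def elim: Ints_cases)
  qed (auto simp: \<alpha>_def intro: exI[of _ 0])
  with v0 obtain n0 where v0': "v0 \<in> weight_space scale act (\<alpha> + of_int n0, F, c, d, e)" by blast
  note rep = weight_rep[OF assms(2,3,5) v0' v0(2)]
  obtain \<beta> f where 0: "c = 0" "d = 0" "e = 0" and f: "inj f"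
    "\<And>u v. f (u + v) = f u + f v" "\<And>z v. f (scale z v) = fscale z (f v)"
    and fX: "\<And>i v. f (act (hv_basis (X i)) v) = intermediate_act \<alpha> \<beta> F (hv_basis (X i)) (f v)"
    and fI: "\<And>i v. f (act (hv_basis (I i)) v) = intermediate_act \<alpha> \<beta> F (hv_basis (I i)) (f v)"
    and range: "range f = UNIV \<or> (\<alpha> = 0 \<and> \<beta> = 1 \<and> F = 0 \<and> range f = V_prime)"
    using hv_weight_rep.embedding_exists[OF rep(1) int] by metis
  have f0: "f 0 = 0" using f(2)[of 0 0] by simp
  have basis: "f (act (hv_basis a) v) = intermediate_act \<alpha> \<beta> F (hv_basis a) (f v)" for a v
    by (cases a) (simp_all add: fX fI rep(2-4) 0 f0 intermediate_act_central)
  have "f (act x v) = intermediate_act \<alpha> \<beta> F x (f v)" for x v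
  proof (induction x rule: poly_mapping_basis_induct)
    case (single a z)
    have "intermediate_act \<alpha> \<beta> F (fscale z (hv_basis a)) (f v) = fscale z (intermediate_act \<alpha> \<beta> F (hv_basis a) (f v))"
      by (simp only: intermediate_act_def bilinear_ext_scale_left)
    then show ?case by (simp add: act_single[of a z] f basis)
  qed (simp_all add: act_left f f0 intermediate_act_simps)
  then have "module_isomorphic scale act UNIV fscale (intermediate_act \<alpha> \<beta> F) (range f)"
    unfolding module_isomorphic_def using f by (intro exI[of _ f]) (simp add: bij_betw_def)
  with range show ?thesis by (metis (no_types))
qed

end
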